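(* Let $S,S^*$ define a pair of second order PDE's as in the context (integrable, with $1-S_RS_R^*>0$), let $\theta^i$ ($i\in\{0,+,-,1\}$) be an associated tetrad with tetrad parameters $(\alpha,b,b^*,a,a^*,c)$ and conformal parameter $\Phi$, and let $g=\eta_{ij}\theta^i\otimes\theta^j$ be the corresponding degenerate metric on $J^6$. Suppose there is a torsion-free generalized Weyl connection $\omega_{ij}$ for this tetrad, with generalized Weyl one-form $A=A_i\theta^i+A_s\,ds+A_{s^*}\,ds^*$. Then $$\mathcal L_{e_s}g=-2A_s\,g,\qquad \mathcal L_{e_{s^*}}g=-2A_{s^*}\,g .$$ Consequently $g$ yields a conformal four-metric on the (local) solution space $\mathfrak M^4$: writing $g=g_{ab}(x,s,s^* )\,dx^a\otimes dx^b$ in local coordinates $(x^a,s,s^* )$ in which $x^a$ label the integral surfaces of $e_s,e_{s^*}$, the metrics $g_{ab}(x,s,s^* )$ for different values of $(s,s^* )$ on the same (connected) integral surface are conformally related, motion along $e_s$ or $e_{s^*}$ generating a conformal rescaling of the metric.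
   Context: Setting. $J^6$ is (an open subset of) the space with coordinates $(Z,W,W^*,R,s,s^* )$, where $Z,R$ are real, and $(W,W^* )$, $(s,s^* )$ are complex-conjugate pairs; $^*$ denotes complex conjugation, subscripts $Z,W,W^*,R,s,s^*$ denote partial derivatives, and all functions are smooth. A function $S$ on $J^6$ and its conjugate $S^*$ define the pair of PDE's $Z_{ss}=S(Z,Z_s,Z_{s^*},Z_{ss^*},s,s^* )$, $Z_{s^*s^*}=S^*(Z,Z_s,Z_{s^*},Z_{ss^*},s,s^* )$ for a real function $Z(s,s^* )$, with the notation $(W,W^*,R)=(Z_s,Z_{s^*},Z_{ss^*})$. Assume $1-S_RS_R^*>0$. Define $$T=\frac{S_{s^*}+W^*S_Z+RS_W+S^*S_{W^*}+S_R(S^*_s+WS^*_Z+SS^*_W+RS^*_{W^*})}{1-S_RS_R^*},$$ $T^*$ its conjugate, and the vector fields $$e_s=D=\partial_s+W\partial_Z+S\partial_W+R\partial_{W^*}+T\partial_R,\qquad e_{s^*}=D^*=\partial_{s^*}+W^*\partial_Z+R\partial_W+S^*\partial_{W^*}+T^*\partial_R,$$ so that $T=D^*S$, $T^*=DS^*$. Assume the integrability condition $D^2S^*=D^{*2}S$ (then $[D,D^*]=0$). The solution space $\mathfrak M^4$ is the four-dimensional space of integral surfaces of $D,D^*$, with local coordinates $x^a$; locally $(x^a,s,s^* )$ are coordinates on $J^6$. Tetrad. Put $\beta^0=dZ-W\,ds-W^*ds^*$, $\beta^+=dW-S\,ds-R\,ds^*$, $\beta^-=dW^*-R\,ds-S^*ds^*$,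 $\beta^1=dR-T\,ds-T^*ds^*$, and $$\theta^0=\Phi\beta^0,\quad \theta^+=\Phi\alpha(\beta^++b\beta^-),\quad \theta^-=\Phi\alpha(\beta^-+b^*\beta^+),\quad \theta^1=\Phi(\beta^1+a\beta^++a^*\beta^-+c\beta^0),$$ where the "tetrad parameters" $\alpha,c$ (real), $b,a$ (complex, with conjugates $b^*,a^*$) and the "conformal parameter" $\Phi$ (real, nowhere zero) are functions on $J^6$ with $\alpha\ne0$, $bb^*\neq1$. Together with $\theta^s=ds$, $\theta^{s^*}=ds^*$ these form a coframe of $J^6$. Lower-case indices run over $\{0,+,-,1\}$. $\eta_{ij}$ is the constant symmetric matrix with $\eta_{01}=\eta_{10}=1$, $\eta_{+-}=\eta_{-+}=-1$ and all other entries $0$; indices are raised and lowered with $\eta$. The metric is $g=\eta_{ij}\theta^i\otimes\theta^j$ (degenerate on $J^6$). A torsion-free generalized Weyl connection for the tetrad is a matrix of one-forms $\omega_{ij}$ on $J^6$ with $d\theta^i+\eta^{ik}\omega_{kj}\wedge\theta^j=0$ and $\omega_{ij}=\omega_{[ij]}+\eta_{ij}A$ for some one-form $A=A_i\theta^i+A_s\theta^s+A_{s^*}\theta^{s^*}$ (the generalized Weyl one-form). $\mathcal L$ denotes the Lie derivative. *)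

theory Defs
  imports "HOL-Analysis.Analysis"
begin

subsection \<open>Smooth functions and Wirtinger derivatives\<close>

primrec Ck_on :: "nat \<Rightarrow> 'a::euclidean_space set \<Rightarrow> ('a \<Rightarrow> 'b::real_normed_vector) \<Rightarrow> bool" where
  "Ck_on 0 U f \<longleftrightarrow> continuous_on U f"
| "Ck_on (Suc k) U f \<longleftrightarrow>
     (\<forall>x\<in>U. f differentiable (at x)) \<and>
     (\<forall>v. Ck_on k U (\<lambda>x. frechet_derivative f (at x) v))"

text \<open>Only used on open sets.\<close>

definition smooth_on :: "'a::euclidean_space set \<Rightarrow> ('a \<Rightarrow> 'b::real_normed_vector) \<Rightarrow> bool" where
  "smooth_on U f \<longleftrightarrow> (\<forall>k. Ck_on k U f)"

text \<open>If \<open>u\<close>, \<open>v\<close> are the directions of the real and the imaginary part of a complex coordinate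
  \<open>w\<close>, these are the derivatives with respect to \<open>w\<close> and to its conjugate.\<close>

definition wirt :: "'a::euclidean_space \<Rightarrow> 'a \<Rightarrow> ('a \<Rightarrow> complex) \<Rightarrow> 'a \<Rightarrow> complex" where
  "wirt u v f p = (frechet_derivative f (at p) u - \<i> * frechet_derivative f (at p) v) / 2"

definition wirt_cnj :: "'a::euclidean_space \<Rightarrow> 'a \<Rightarrow> ('a \<Rightarrow> complex) \<Rightarrow> 'a \<Rightarrow> complex" where
  "wirt_cnj u v f p = (frechet_derivative f (at p) u + \<i> * frechet_derivative f (at p) v) / 2"


subsection \<open>Tensor calculus on the six-dimensional jet space\<close>

text \<open>A point \<open>(Z, W, R, s)\<close>; the coordinates \<open>W\<^sup>*\<close> and \<open>s\<^sup>*\<close> are the conjugates of \<open>W\<close> and \<open>s\<close>.\<close>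

type_synonym jet = "real \<times> complex \<times> real \<times> complex"

definition jZ :: "jet \<Rightarrow> real" where "jZ p = fst p"
definition jW :: "jet \<Rightarrow> complex" where "jW p = fst (snd p)"
definition jR :: "jet \<Rightarrow> real" where "jR p = fst (snd (snd p))"
definition js :: "jet \<Rightarrow> complex" where "js p = snd (snd (snd p))"

text \<open>Names of the six coordinates \<open>(Z, W, W\<^sup>*, R, s, s\<^sup>*)\<close>. All (complexified) tensors are given by
  their components with respect to the corresponding coordinate frame, in which \<open>\<partial>\<^sub>W\<close>, \<open>dW\<close>, etc. are
  complex-valued.\<close>

datatype coord = CZ | CW | CWc | CR | Cs | Csc

lemma UNIV_coord: "UNIV = {CZ, CW, CWc, CR, Cs, Csc}"
  using coord.exhaust by auto

instance coord :: finite
  by standard (simp add: UNIV_coord)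

fun coord_fun :: "coord \<Rightarrow> jet \<Rightarrow> complex" where
  "coord_fun CZ p = of_real (jZ p)"
| "coord_fun CW p = jW p"
| "coord_fun CWc p = cnj (jW p)"
| "coord_fun CR p = of_real (jR p)"
| "coord_fun Cs p = js p"
| "coord_fun Csc p = cnj (js p)"

fun pd :: "coord \<Rightarrow> (jet \<Rightarrow> complex) \<Rightarrow> jet \<Rightarrow> complex" where
  "pd CZ f p = frechet_derivative f (at p) (1, 0, 0, 0)"
| "pd CW f p = wirt (0, 1, 0, 0) (0, \<i>, 0, 0) f p"
| "pd CWc f p = wirt_cnj (0, 1, 0, 0) (0, \<i>, 0, 0) f p"
| "pd CR f p = frechet_derivative f (at p) (0, 0, 1, 0)"
| "pd Cs f p = wirt (0, 0, 0, 1) (0, 0, 0, \<i>) f p"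
| "pd Csc f p = wirt_cnj (0, 0, 0, 1) (0, 0, 0, \<i>) f p"

type_synonym vfield = "jet \<Rightarrow> coord \<Rightarrow> complex"
type_synonym form1 = "jet \<Rightarrow> coord \<Rightarrow> complex"
type_synonym tensor2 = "jet \<Rightarrow> coord \<Rightarrow> coord \<Rightarrow> complex"

definition vapp :: "vfield \<Rightarrow> (jet \<Rightarrow> complex) \<Rightarrow> jet \<Rightarrow> complex" where
  "vapp X f p = (\<Sum>k\<in>UNIV. X p k * pd k f p)"

definition dcoord :: "coord \<Rightarrow> form1" where
  "dcoord k p m = of_bool (m = k)"

definition dfun :: "(jet \<Rightarrow> complex) \<Rightarrow> form1" where
  "dfun f p m = pd m f p"

definition ext_d :: "form1 \<Rightarrow> tensor2" where
  "ext_d \<omega> p m n = pd m (\<lambda>q. \<omega> q n) p - pd n (\<lambda>q. \<omega> q m) p"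

definition wedge :: "form1 \<Rightarrow> form1 \<Rightarrow> tensor2" where
  "wedge \<omega> \<theta> p m n = \<omega> p m * \<theta> p n - \<omega> p n * \<theta> p m"

definition lie_deriv :: "vfield \<Rightarrow> tensor2 \<Rightarrow> tensor2" where
  "lie_deriv X g p m n =
     (\<Sum>k\<in>UNIV. X p k * pd k (\<lambda>q. g q m n) p
             + g p k n * pd m (\<lambda>q. X q k) p
             + g p m k * pd n (\<lambda>q. X q k) p)"

definition smooth_form :: "jet set \<Rightarrow> form1 \<Rightarrow> bool" where
  "smooth_form U \<omega> \<longleftrightarrow> (\<forall>m. smooth_on U (\<lambda>p. \<omega> p m))"


subsection \<open>The pair of differential equations\<close>

abbreviation cnjf :: "('a \<Rightarrow> complex) \<Rightarrow> 'a \<Rightarrow> complex" where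
  "cnjf f \<equiv> (\<lambda>p. cnj (f p))"

definition TT :: "(jet \<Rightarrow> complex) \<Rightarrow> jet \<Rightarrow> complex" where
  "TT S p =
     (pd Csc S p + cnj (jW p) * pd CZ S p + of_real (jR p) * pd CW S p + cnj (S p) * pd CWc S p
      + pd CR S p * (pd Cs (cnjf S) p + jW p * pd CZ (cnjf S) p
                     + S p * pd CW (cnjf S) p + of_real (jR p) * pd CWc (cnjf S) p))
     / (1 - pd CR S p * pd CR (cnjf S) p)"

fun e_s :: "(jet \<Rightarrow> complex) \<Rightarrow> vfield" where
  "e_s S p CZ = jW p"
| "e_s S p CW = S p"
| "e_s S p CWc = of_real (jR p)"
| "e_s S p CR = TT S p"
| "e_s S p Cs = 1"
| "e_s S p Csc = 0"

fun e_sc :: "(jet \<Rightarrow> complex) \<Rightarrow> vfield" where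
  "e_sc S p CZ = cnj (jW p)"
| "e_sc S p CW = of_real (jR p)"
| "e_sc S p CWc = cnj (S p)"
| "e_sc S p CR = cnj (TT S p)"
| "e_sc S p Cs = 0"
| "e_sc S p Csc = 1"

text \<open>The number whose real part is taken below is real, since \<open>R\<close> is a real coordinate.\<close>

definition integrable_pde_pair :: "jet set \<Rightarrow> (jet \<Rightarrow> complex) \<Rightarrow> bool" where
  "integrable_pde_pair U S \<longleftrightarrow>
     open U \<and> smooth_on U S \<and>
     (\<forall>p\<in>U. Re (1 - pd CR S p * pd CR (cnjf S) p) > 0) \<and>
     (\<forall>p\<in>U. vapp (e_s S) (vapp (e_s S) (cnjf S)) p = vapp (e_sc S) (vapp (e_sc S) S) p)"


subsection \<open>Tetrad, metric and generalized Weyl connection\<close>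

text \<open>The indices \<open>0, +, -, 1\<close>.\<close>

datatype tet = T0 | Tp | Tm | T1

lemma UNIV_tet: "UNIV = {T0, Tp, Tm, T1}"
  using tet.exhaust by auto

instance tet :: finite
  by standard (simp add: UNIV_tet)

definition eta :: "tet \<Rightarrow> tet \<Rightarrow> complex" where
  "eta i j = (if (i, j) \<in> {(T0, T1), (T1, T0)} then 1
              else if (i, j) \<in> {(Tp, Tm), (Tm, Tp)} then - 1 else 0)"

text \<open>The matrix is its own inverse, so \<open>eta\<close> is used both for \<open>\<eta>\<close> with lower and with upper
  indices.\<close>

lemma eta_inverse: "(\<Sum>k\<in>UNIV. eta i k * eta k j) = of_bool (i = j)"
  by (cases i; cases j) (simp_all add: UNIV_tet eta_def)

fun beta :: "(jet \<Rightarrow> complex) \<Rightarrow> tet \<Rightarrow> form1" where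
  "beta S T0 p m = dcoord CZ p m - jW p * dcoord Cs p m - cnj (jW p) * dcoord Csc p m"
| "beta S Tp p m = dcoord CW p m - S p * dcoord Cs p m - of_real (jR p) * dcoord Csc p m"
| "beta S Tm p m = dcoord CWc p m - of_real (jR p) * dcoord Cs p m - cnj (S p) * dcoord Csc p m"
| "beta S T1 p m = dcoord CR p m - TT S p * dcoord Cs p m - cnj (TT S p) * dcoord Csc p m"

definition tetrad_params ::
  "jet set \<Rightarrow> (jet \<Rightarrow> real) \<Rightarrow> (jet \<Rightarrow> real) \<Rightarrow> (jet \<Rightarrow> complex) \<Rightarrow> (jet \<Rightarrow> complex)
     \<Rightarrow> (jet \<Rightarrow> real) \<Rightarrow> bool" where
  "tetrad_params U \<Phi> \<alpha> b a c \<longleftrightarrow>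
     smooth_on U \<Phi> \<and> smooth_on U \<alpha> \<and> smooth_on U b \<and> smooth_on U a \<and> smooth_on U c \<and>
     (\<forall>p\<in>U. \<Phi> p \<noteq> 0 \<and> \<alpha> p \<noteq> 0 \<and> b p * cnj (b p) \<noteq> 1)"

fun theta ::
  "(jet \<Rightarrow> complex) \<Rightarrow> (jet \<Rightarrow> real) \<Rightarrow> (jet \<Rightarrow> real) \<Rightarrow> (jet \<Rightarrow> complex) \<Rightarrow> (jet \<Rightarrow> complex)
     \<Rightarrow> (jet \<Rightarrow> real) \<Rightarrow> tet \<Rightarrow> form1" where
  "theta S \<Phi> \<alpha> b a c T0 p m = of_real (\<Phi> p) * beta S T0 p m"
| "theta S \<Phi> \<alpha> b a c Tp p m =
     of_real (\<Phi> p * \<alpha> p) * (beta S Tp p m + b p * beta S Tm p m)"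
| "theta S \<Phi> \<alpha> b a c Tm p m =
     of_real (\<Phi> p * \<alpha> p) * (beta S Tm p m + cnj (b p) * beta S Tp p m)"
| "theta S \<Phi> \<alpha> b a c T1 p m =
     of_real (\<Phi> p) * (beta S T1 p m + a p * beta S Tp p m + cnj (a p) * beta S Tm p m
                       + of_real (c p) * beta S T0 p m)"

definition tetrad_metric :: "(tet \<Rightarrow> form1) \<Rightarrow> tensor2" where
  "tetrad_metric \<theta> p m n = (\<Sum>i\<in>UNIV. \<Sum>j\<in>UNIV. eta i j * \<theta> i p m * \<theta> j p n)"

definition weyl_form ::
  "(tet \<Rightarrow> form1) \<Rightarrow> (tet \<Rightarrow> jet \<Rightarrow> complex) \<Rightarrow> (jet \<Rightarrow> complex) \<Rightarrow> (jet \<Rightarrow> complex) \<Rightarrow> form1" where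
  "weyl_form \<theta> At As Asc p m =
     (\<Sum>i\<in>UNIV. At i p * \<theta> i p m) + As p * dcoord Cs p m + Asc p * dcoord Csc p m"

definition torsion_free_gen_weyl ::
  "jet set \<Rightarrow> (tet \<Rightarrow> form1) \<Rightarrow> (tet \<Rightarrow> tet \<Rightarrow> form1) \<Rightarrow> form1 \<Rightarrow> bool" where
  "torsion_free_gen_weyl U \<theta> \<omega> A \<longleftrightarrow>
     (\<forall>i j. smooth_form U (\<omega> i j)) \<and> smooth_form U A \<and>
     (\<forall>p\<in>U. \<forall>i m n. ext_d (\<theta> i) p m n
        + (\<Sum>k\<in>UNIV. \<Sum>j\<in>UNIV. eta i k * wedge (\<omega> k j) (\<theta> j) p m n) = 0) \<and>
     (\<forall>p\<in>U. \<forall>i j m. \<omega> i j p m = (\<omega> i j p m - \<omega> j i p m) / 2 + eta i j * A p m)"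


subsection \<open>Integral surfaces and local coordinates on the solution space\<close>

text \<open>A (connected) integral surface of \<open>e_s\<close>, \<open>e_sc\<close> is parametrised by \<open>s\<close>: it is the set of points
  \<open>(Z, Z\<^sub>s, Z\<^sub>s\<^sub>s\<^sub>*, s)\<close> for a solution \<open>Z(s, s\<^sup>*)\<close> of the pair of equations.\<close>

definition integral_surface :: "(jet \<Rightarrow> complex) \<Rightarrow> jet set \<Rightarrow> jet set \<Rightarrow> bool" where
  "integral_surface S V N \<longleftrightarrow>
     N \<subseteq> V \<and>
     (\<exists>\<Sigma> \<Gamma>. open \<Sigma> \<and> connected \<Sigma> \<and> \<Sigma> \<noteq> {} \<and> smooth_on \<Sigma> \<Gamma> \<and> N = \<Gamma> ` \<Sigma> \<and>
        (\<forall>\<sigma>\<in>\<Sigma>. js (\<Gamma> \<sigma>) = \<sigma> \<and>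
          (\<forall>k. wirt 1 \<i> (\<lambda>\<tau>. coord_fun k (\<Gamma> \<tau>)) \<sigma> = e_s S (\<Gamma> \<sigma>) k \<and>
               wirt_cnj 1 \<i> (\<lambda>\<tau>. coord_fun k (\<Gamma> \<tau>)) \<sigma> = e_sc S (\<Gamma> \<sigma>) k)))"

text \<open>\<open>p \<mapsto> (x p, js p)\<close> is a chart of the open set \<open>V\<close> with range \<open>Y\<close> and inverse \<open>\<phi>\<close>, and \<open>x\<close> labels
  the integral surfaces in \<open>V\<close>, so that \<open>x ` V\<close> is the local solution space in the coordinates \<open>x\<close>.\<close>

definition solution_coords ::
  "jet set \<Rightarrow> (jet \<Rightarrow> complex) \<Rightarrow> jet set \<Rightarrow> (jet \<Rightarrow> real ^ 4) \<Rightarrow> ((real ^ 4) \<times> complex) set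
     \<Rightarrow> ((real ^ 4) \<times> complex \<Rightarrow> jet) \<Rightarrow> bool" where
  "solution_coords U S V x Y \<phi> \<longleftrightarrow>
     open V \<and> V \<subseteq> U \<and> open Y \<and>
     smooth_on V x \<and> smooth_on Y \<phi> \<and>
     (\<lambda>p. (x p, js p)) ` V = Y \<and> (\<forall>p\<in>V. \<phi> (x p, js p) = p) \<and>
     (\<forall>p\<in>V. \<forall>q\<in>V. x p = x q \<longleftrightarrow> (\<exists>N. integral_surface S V N \<and> p \<in> N \<and> q \<in> N))"

text \<open>Derivatives with respect to \<open>s\<close>, \<open>s\<^sup>*\<close> in the coordinates \<open>(x, s, s\<^sup>*)\<close>.\<close>

definition chart_ds :: "((real ^ 4) \<times> complex \<Rightarrow> complex) \<Rightarrow> (real ^ 4) \<times> complex \<Rightarrow> complex" where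
  "chart_ds f y = wirt (0, 1) (0, \<i>) f y"

definition chart_dsc :: "((real ^ 4) \<times> complex \<Rightarrow> complex) \<Rightarrow> (real ^ 4) \<times> complex \<Rightarrow> complex" where
  "chart_dsc f y = wirt_cnj (0, 1) (0, \<i>) f y"

end

theory Submission
  imports Defs
begin

text \<open>Since \<open>e\<^sub>s\<close> is annihilated by the tetrad, Cartan's formula and the first structure equation give
  \<open>L \<theta>\<^sup>i = - \<eta>\<^sup>i\<^sup>k \<omega>\<^sub>k\<^sub>j(e\<^sub>s) \<theta>\<^sup>j\<close>; only the symmetric part \<open>\<eta>\<^sub>i\<^sub>j A\<^sub>s\<close> of \<open>\<omega>\<^sub>i\<^sub>j(e\<^sub>s)\<close> contributes to
  \<open>L g\<close>. In a chart \<open>(x, s, s\<^sup>*)\<close> with inverse \<open>\<phi>\<close> the slices \<open>s \<mapsto> \<phi>(x, s)\<close> are the integral surfaces,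
  so \<open>\<partial>\<^sub>s \<phi> = e\<^sub>s\<close>, and by symmetry of second derivatives the \<open>s\<close>-derivative of
  \<open>G\<^sub>k\<^sub>l = g(\<partial>\<^sub>k \<phi>, \<partial>\<^sub>l \<phi>)\<close> is \<open>(L g)(\<partial>\<^sub>k \<phi>, \<partial>\<^sub>l \<phi>) = - 2 A\<^sub>s G\<^sub>k\<^sub>l\<close>. Hence the normalised matrix
  \<open>G / \<bar>G\<bar>\<close> is constant along a connected integral surface.\<close>

subsection \<open>Calculus of smooth functions\<close>

text \<open>Two descriptions of tangent vectors meet in the proof. Tensors have components in the
  complexified frame \<open>\<partial>\<^sub>W\<close>, \<open>\<partial>\<^sub>W\<^sub>*\<close>,
  ..., while differentiating the chart inverse \<open>\<phi>\<close> gives real vectors. The bridge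
  is that every \<open>coord_fun k\<close> is real linear, hence its own differential: applied to a
  real vector it returns a complexified component, and a complex covector is determined by its
  values on real vectors.

  Normalising \<open>G\<close> requires that it be real and never zero. It is real because
  conjugation exchanges the \<open>+\<close> and \<open>-\<close> forms, an exchange that
  \<open>eta\<close> respects. It is nonzero because it is even nondegenerate: the tetrad forms are
  independent, and together with \<open>ds\<close> they separate tangent vectors. Passing to the
  norm-one matrix avoids integrating the one-form with components \<open>As\<close>,
  \<open>Asc\<close> along the surface: its vanishing derivative and connectedness suffice.\<close>

lemma Ck_on_cong:
  assumes "open U" "\<And>x. x \<in> U \<Longrightarrow> f x = g x"
  shows "Ck_on k U f \<longleftrightarrow> Ck_on k U g"
proof -
  have "Ck_on k U g" if "open U" "\<And>x. x \<in> U \<Longrightarrow> f x = g x" "Ck_on k U f" for f g :: "'a \<Rightarrow> 'b"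
    using that
  proof (induction k arbitrary: f g)
    case 0
    then show ?case by (simp cong: continuous_on_cong)
  next
    case (Suc k)
    have df: "f differentiable at x" if "x \<in> U" for x
      using Suc.prems(3) that by simp
    have "g differentiable at x" if "x \<in> U" for x
      using df[OF that] Suc.prems that
      by (metis differentiable_def has_derivative_transform_within_open)
    moreover have "Ck_on k U (\<lambda>x. frechet_derivative g (at x) v)" for v
    proof (rule Suc.IH)
      show "frechet_derivative f (at x) v = frechet_derivative g (at x) v" if "x \<in> U" for x
        using frechet_derivative_transform_within_open[OF df[OF that] Suc.prems(1) that Suc.prems(2)]
        by simp
    qed (use Suc.prems in auto)
    ultimately show ?case by simp
  qed
  from this[of f g] this[of g f] assms show ?thesis by auto
qed

text \<open>By uniqueness of derivatives any explicit candidate \<open>f'\<close> agrees on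
  \<open>U\<close> with the chosen \<open>frechet_derivative\<close>. The inductive closure proofs
  below can therefore work with the formula that the relevant differentiation rule produces.\<close>

lemma Ck_on_SucI:
  assumes "open U" "\<And>x. x \<in> U \<Longrightarrow> (f has_derivative f' x) (at x)"
    and "\<And>v. Ck_on k U (\<lambda>x. f' x v)"
  shows "Ck_on (Suc k) U f"
proof -
  have "Ck_on k U (\<lambda>x. frechet_derivative f (at x) v)" for v
    using assms(3)[of v]
    by (rule Ck_on_cong[THEN iffD1, rotated 2])
      (use assms in \<open>auto dest!: assms(2) simp flip: frechet_derivative_at\<close>)
  with assms(2) show ?thesis by (auto intro: differentiableI)
qed

lemma Ck_on_continuous: "Ck_on k U f \<Longrightarrow> continuous_on U f"
  by (cases k)
    (auto simp: continuous_on_eq_continuous_within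
      intro: differentiable_imp_continuous_within continuous_at_imp_continuous_at_within)

text \<open>Product, quotient and chain rules leave undifferentiated factors behind; in the
  induction these are needed at the lower order.\<close>

lemma Ck_on_SucD: "Ck_on (Suc k) U f \<Longrightarrow> Ck_on k U f"
proof (induction k arbitrary: f)
  case 0
  then show ?case using Ck_on_continuous[of "Suc 0" U f] by simp
qed auto

lemma Ck_on_Suc_deriv:
  assumes "Ck_on (Suc k) U f" "x \<in> U"
  shows "(f has_derivative frechet_derivative f (at x)) (at x)"
  using assms by (simp add: frechet_derivative_works)

lemma Ck_on_const: "open U \<Longrightarrow> Ck_on k U (\<lambda>x. c)"
proof (induction k arbitrary: c)
  case (Suc k)
  show ?case by (rule Ck_on_SucI[where f' = "\<lambda>_ _. 0"]) (use Suc in auto)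
qed simp

lemma Ck_on_bounded_linear:
  assumes "open U" "bounded_linear h" "Ck_on k U f"
  shows "Ck_on k U (\<lambda>x. h (f x))"
  using assms(3)
proof (induction k arbitrary: f)
  case 0
  then show ?case
    using assms by (auto intro: bounded_linear.continuous_on)
next
  case (Suc k)
  show ?case
    by (rule Ck_on_SucI[where f' = "\<lambda>x v. h (frechet_derivative f (at x) v)"])
      (use Suc assms in \<open>auto intro!: bounded_linear.has_derivative[OF assms(2)] Ck_on_Suc_deriv\<close>)
qed

lemma Ck_on_ident: "open U \<Longrightarrow> Ck_on k U (\<lambda>x. x)"
proof (induction k)
  case (Suc k)
  show ?case by (rule Ck_on_SucI[where f' = "\<lambda>_ v. v"]) (use Suc in \<open>auto intro: Ck_on_const\<close>)
qed (simp add: continuous_on_id)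

lemma Ck_on_add:
  assumes "open U" "Ck_on k U f" "Ck_on k U g"
  shows "Ck_on k U (\<lambda>x. f x + g x)"
  using assms(2,3)
proof (induction k arbitrary: f g)
  case (Suc k)
  show ?case
    by (rule Ck_on_SucI[where f' = "\<lambda>x v. frechet_derivative f (at x) v + frechet_derivative g (at x) v"])
      (use Suc assms in \<open>auto intro!: has_derivative_add Ck_on_Suc_deriv\<close>)
qed (auto intro: continuous_on_add)

lemma Ck_on_sum:
  assumes "open U" "\<And>i. i \<in> I \<Longrightarrow> Ck_on k U (f i)"
  shows "Ck_on k U (\<lambda>x. \<Sum>i\<in>I. f i x)"
  using assms(2)
  by (induction I rule: infinite_finite_induct) (auto intro: Ck_on_const Ck_on_add assms(1))

text \<open>Stated for an arbitrary bilinear product so that one induction serves both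
  multiplication and scalar multiplication.\<close>

lemma (in bounded_bilinear) Ck_on:
  assumes "open U" "Ck_on k U f" "Ck_on k U g"
  shows "Ck_on k U (\<lambda>x. prod (f x) (g x))"
  using assms(2,3)
proof (induction k arbitrary: f g)
  case (Suc k)
  have f: "Ck_on k U f" "\<And>v. Ck_on k U (\<lambda>x. frechet_derivative f (at x) v)"
    and g: "Ck_on k U g" "\<And>v. Ck_on k U (\<lambda>x. frechet_derivative g (at x) v)"
    using Suc.prems Ck_on_SucD by auto
  show ?case
    by (rule Ck_on_SucI[where f' = "\<lambda>x v. prod (f x) (frechet_derivative g (at x) v)
          + prod (frechet_derivative f (at x) v) (g x)"])
      (intro assms FDERIV Ck_on_add Suc.IH f g Ck_on_Suc_deriv[OF Suc.prems(1)]
        Ck_on_Suc_deriv[OF Suc.prems(2)]; assumption)+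
qed (auto intro: continuous_on)

lemma Ck_on_inverse:
  fixes f :: "'a::euclidean_space \<Rightarrow> 'b::real_normed_div_algebra"
  assumes "open U" "Ck_on k U f" "\<And>x. x \<in> U \<Longrightarrow> f x \<noteq> 0"
  shows "Ck_on k U (\<lambda>x. inverse (f x))"
  using assms(2)
proof (induction k)
  case (Suc k)
  have f: "Ck_on k U f" by (rule Ck_on_SucD) fact
  have f': "Ck_on k U (\<lambda>x. frechet_derivative f (at x) v)" for v
    using Suc.prems by simp
  have "Ck_on k U (\<lambda>x. - (inverse (f x) * frechet_derivative f (at x) v * inverse (f x)))" for v
    by (rule Ck_on_bounded_linear[OF assms(1) bounded_linear_minus[OF bounded_linear_ident]])
      (intro bounded_bilinear.Ck_on[OF bounded_bilinear_mult] assms Suc.IH f f')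
  then show ?case
    by (rule Ck_on_SucI[OF assms(1), rotated])
      (rule Deriv.has_derivative_inverse[OF assms(3) Ck_on_Suc_deriv[OF Suc.prems]])
qed (use assms in \<open>auto intro: continuous_on_inverse\<close>)

lemma linear_sum_Basis:
  assumes "linear h"
  shows "h v = (\<Sum>b\<in>Basis. (v \<bullet> b) *\<^sub>R h b)"
proof -
  have "h v = h (\<Sum>b\<in>Basis. (v \<bullet> b) *\<^sub>R b)" by (simp add: euclidean_representation)
  also have "\<dots> = (\<Sum>b\<in>Basis. (v \<bullet> b) *\<^sub>R h b)"
    using assms by (simp add: linear_sum linear_cmul)
  finally show ?thesis .
qed

text \<open>The chain rule differentiates \<open>g\<close> in the direction \<open>f'(x) v\<close>,
  which moves with \<open>x\<close>, whereas \<open>Ck_on\<close> only controls fixed directions.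
  Expanding this direction in the basis leaves finitely many fixed-direction derivatives of
  \<open>g\<close>, each composed with \<open>f\<close>; hence the induction is general in
  \<open>g\<close>.\<close>

lemma Ck_on_compose:
  fixes f :: "'a::euclidean_space \<Rightarrow> 'b::euclidean_space" and g :: "'b \<Rightarrow> 'c::real_normed_vector"
  assumes "open U" "open V" "Ck_on k U f" "Ck_on k V g" "f ` U \<subseteq> V"
  shows "Ck_on k U (\<lambda>x. g (f x))"
  using assms(3,4)
proof (induction k arbitrary: g)
  case 0
  then show ?case using assms(5) by (auto intro: continuous_on_compose2)
next
  case (Suc k)
  have f: "Ck_on k U f" by (rule Ck_on_SucD) (rule Suc.prems)
  let ?h = "\<lambda>x v. \<Sum>b\<in>Basis. (frechet_derivative f (at x) v \<bullet> b) *\<^sub>R frechet_derivative g (at (f x)) b"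
  show ?case
  proof (rule Ck_on_SucI[where f' = ?h])
    fix x assume x: "x \<in> U"
    then have fx: "f x \<in> V" using assms(5) by auto
    have "frechet_derivative g (at (f x)) (frechet_derivative f (at x) v) = ?h x v" for v
      by (rule linear_sum_Basis)
        (use has_derivative_bounded_linear[OF Ck_on_Suc_deriv[OF Suc.prems(2) fx]]
          in \<open>rule bounded_linear.linear\<close>)
    then show "((\<lambda>x. g (f x)) has_derivative ?h x) (at x)"
      using has_derivative_compose[OF Ck_on_Suc_deriv[OF Suc.prems(1) x] Ck_on_Suc_deriv[OF Suc.prems(2) fx]]
      by simp
  next
    fix v
    have "Ck_on k U (\<lambda>x. frechet_derivative f (at x) v \<bullet> b)" for b
      using Suc.prems by (intro Ck_on_bounded_linear[OF _ bounded_linear_inner_left] assms) simp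
    moreover have "Ck_on k U (\<lambda>x. frechet_derivative g (at (f x)) b)" for b
      by (rule Suc.IH[OF f]) (use Suc.prems in simp)
    ultimately show "Ck_on k U (\<lambda>x. ?h x v)"
      by (intro Ck_on_sum bounded_bilinear.Ck_on[OF bounded_bilinear_scaleR] assms) auto
  qed (rule assms)
qed

section \<open>Closure properties of smooth functions\<close>

lemma smooth_on_cong:
  "open U \<Longrightarrow> (\<And>x. x \<in> U \<Longrightarrow> f x = g x) \<Longrightarrow> smooth_on U f \<longleftrightarrow> smooth_on U g"
  unfolding smooth_on_def using Ck_on_cong[of U f g] by simp

lemma smooth_on_imp_differentiable: "smooth_on U f \<Longrightarrow> x \<in> U \<Longrightarrow> f differentiable at x"
  unfolding smooth_on_def by (auto dest: spec[of _ "Suc 0"])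

lemma smooth_on_has_derivative:
  "smooth_on U f \<Longrightarrow> x \<in> U \<Longrightarrow> (f has_derivative frechet_derivative f (at x)) (at x)"
  using smooth_on_imp_differentiable frechet_derivative_works by blast

lemma smooth_on_imp_continuous_on: "smooth_on U f \<Longrightarrow> continuous_on U f"
  unfolding smooth_on_def using Ck_on_continuous by blast

lemma smooth_on_frechet_derivative:
  "smooth_on U f \<Longrightarrow> smooth_on U (\<lambda>x. frechet_derivative f (at x) v)"
  unfolding smooth_on_def by (metis Ck_on.simps(2))

lemma smooth_on_const: "open U \<Longrightarrow> smooth_on U (\<lambda>x. c)"
  by (simp add: smooth_on_def Ck_on_const)

lemma smooth_on_bounded_linear_compose:
  "open U \<Longrightarrow> bounded_linear h \<Longrightarrow> smooth_on U f \<Longrightarrow> smooth_on U (\<lambda>x. h (f x))"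
  by (simp add: smooth_on_def Ck_on_bounded_linear)

lemma smooth_on_bounded_linear: "open U \<Longrightarrow> bounded_linear h \<Longrightarrow> smooth_on U h"
  using smooth_on_bounded_linear_compose[of U h "\<lambda>x. x"] by (simp add: smooth_on_def Ck_on_ident)

lemma smooth_on_add:
  "open U \<Longrightarrow> smooth_on U f \<Longrightarrow> smooth_on U g \<Longrightarrow> smooth_on U (\<lambda>x. f x + g x)"
  by (simp add: smooth_on_def Ck_on_add)

lemma smooth_on_diff:
  "open U \<Longrightarrow> smooth_on U f \<Longrightarrow> smooth_on U g \<Longrightarrow> smooth_on U (\<lambda>x. f x - g x)"
  using smooth_on_add[of U f "\<lambda>x. - g x"]
    smooth_on_bounded_linear_compose[OF _ bounded_linear_minus[OF bounded_linear_ident], of U g]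
  by simp

lemma smooth_on_minus: "open U \<Longrightarrow> smooth_on U f \<Longrightarrow> smooth_on U (\<lambda>x. - f x)"
  by (rule smooth_on_bounded_linear_compose[OF _ bounded_linear_minus[OF bounded_linear_ident]])

lemma smooth_on_sum:
  "open U \<Longrightarrow> (\<And>i. i \<in> I \<Longrightarrow> smooth_on U (f i)) \<Longrightarrow> smooth_on U (\<lambda>x. \<Sum>i\<in>I. f i x)"
  by (simp add: smooth_on_def Ck_on_sum)

lemma smooth_on_mult:
  fixes f g :: "'a::euclidean_space \<Rightarrow> 'b::real_normed_algebra"
  shows "open U \<Longrightarrow> smooth_on U f \<Longrightarrow> smooth_on U g \<Longrightarrow> smooth_on U (\<lambda>x. f x * g x)"
  by (simp add: smooth_on_def bounded_bilinear.Ck_on[OF bounded_bilinear_mult])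

lemma smooth_on_divide:
  fixes f g :: "'a::euclidean_space \<Rightarrow> 'b::real_normed_field"
  shows "open U \<Longrightarrow> smooth_on U f \<Longrightarrow> smooth_on U g \<Longrightarrow> (\<And>x. x \<in> U \<Longrightarrow> g x \<noteq> 0)
    \<Longrightarrow> smooth_on U (\<lambda>x. f x / g x)"
  by (simp add: divide_inverse smooth_on_def bounded_bilinear.Ck_on[OF bounded_bilinear_mult] Ck_on_inverse)

lemma smooth_on_compose:
  fixes f :: "'a::euclidean_space \<Rightarrow> 'b::euclidean_space"
  shows "open U \<Longrightarrow> open V \<Longrightarrow> smooth_on U f \<Longrightarrow> smooth_on V g \<Longrightarrow> f ` U \<subseteq> V
    \<Longrightarrow> smooth_on U (\<lambda>x. g (f x))"
  by (simp add: smooth_on_def Ck_on_compose)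

lemma smooth_on_cnj: "open U \<Longrightarrow> smooth_on U f \<Longrightarrow> smooth_on U (cnjf f)"
  by (rule smooth_on_bounded_linear_compose[OF _ bounded_linear_cnj])

lemma smooth_on_of_real:
  "open U \<Longrightarrow> smooth_on U f \<Longrightarrow> smooth_on U (\<lambda>x. of_real (f x) :: complex)"
  by (rule smooth_on_bounded_linear_compose[OF _ bounded_linear_of_real])

lemma smooth_on_vec_lambda:
  fixes f :: "'n::finite \<Rightarrow> 'a::euclidean_space \<Rightarrow> 'b::real_normed_vector"
  assumes "open U" "\<And>i. smooth_on U (f i)"
  shows "smooth_on U (\<lambda>x. \<chi> i. f i x)"
proof -
  have lin: "bounded_linear (\<lambda>x::'b. axis i x :: 'b ^ 'n)" for i
    by (rule bounded_linear_intro[where K = 1])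
      (auto simp: axis_def vec_eq_iff norm_vec_def L2_set_def if_distrib[where f = norm]
        if_distrib[where f = "\<lambda>x. x\<^sup>2"] cong: if_cong)
  have "(\<lambda>x. \<chi> i. f i x) = (\<lambda>x. \<Sum>i\<in>UNIV. axis i (f i x) :: 'b ^ 'n)"
    by (auto simp: fun_eq_iff vec_eq_iff axis_def)
  then show ?thesis
    using assms by (auto intro!: smooth_on_sum smooth_on_bounded_linear_compose[OF _ lin])
qed

text \<open>Both mixed second derivatives are limits of the second difference quotient.\<close>

lemma second_difference_mean_value:
  fixes f :: "'a::euclidean_space \<Rightarrow> real"
  assumes f: "smooth_on U f"
    and seg: "\<And>s t. 0 \<le> s \<Longrightarrow> s \<le> h \<Longrightarrow> 0 \<le> t \<Longrightarrow> t \<le> h \<Longrightarrow> p + s *\<^sub>R u + t *\<^sub>R v \<in> U" and h: "h > 0"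
  shows "\<exists>s t. 0 < s \<and> s < h \<and> 0 < t \<and> t < h \<and>
    f (p + h *\<^sub>R u + h *\<^sub>R v) - f (p + h *\<^sub>R u) - f (p + h *\<^sub>R v) + f p
      = h * h * frechet_derivative (\<lambda>x. frechet_derivative f (at x) u) (at (p + s *\<^sub>R u + t *\<^sub>R v)) v"
proof -
  let ?D = "\<lambda>x. frechet_derivative f (at x)"
  let ?DD = "\<lambda>x. frechet_derivative (\<lambda>x. frechet_derivative f (at x) u) (at x)"
  have fd: "(f has_derivative ?D x) (at x)" if "x \<in> U" for x
    by (rule smooth_on_has_derivative[OF f that])
  have fdd: "((\<lambda>x. ?D x u) has_derivative ?DD x) (at x)" if "x \<in> U" for x
    by (rule smooth_on_has_derivative[OF smooth_on_frechet_derivative[OF f] that])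
  have lin: "linear (?D x)" "linear (?DD x)" if "x \<in> U" for x
    using fd[OF that] fdd[OF that] by (auto dest: has_derivative_linear)
  \<comment> \<open>The second difference is \<open>F h - F 0\<close>. The mean value theorem along
    \<open>u\<close> turns it into a first difference of the \<open>u\<close>-derivative, and a
    second application along \<open>v\<close> gives the mixed derivative.\<close>
  define F where "F s = f (p + s *\<^sub>R u + h *\<^sub>R v) - f (p + s *\<^sub>R u)" for s
  have F: "(F has_real_derivative ?D (p + s *\<^sub>R u + h *\<^sub>R v) u - ?D (p + s *\<^sub>R u) u) (at s)"
    if "0 \<le> s" "s \<le> h" for s
  proof -
    have inU: "p + s *\<^sub>R u + h *\<^sub>R v \<in> U" "p + s *\<^sub>R u \<in> U"
      using seg[of s h] seg[of s 0] that h by auto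
    have l: "((\<lambda>s. p + s *\<^sub>R u + w) has_derivative (\<lambda>s. s *\<^sub>R u)) (at s)" for w
      by (auto intro!: derivative_eq_intros)
    have "((\<lambda>s. f (p + s *\<^sub>R u + h *\<^sub>R v)) has_derivative (\<lambda>r. ?D (p + s *\<^sub>R u + h *\<^sub>R v) (r *\<^sub>R u))) (at s)"
      by (rule has_derivative_compose[OF l fd[OF inU(1)]])
    moreover have "((\<lambda>s. f (p + s *\<^sub>R u)) has_derivative (\<lambda>r. ?D (p + s *\<^sub>R u) (r *\<^sub>R u))) (at s)"
      using has_derivative_compose[OF l[of 0], of f "?D (p + s *\<^sub>R u)"] fd[OF inU(2)] by simp
    ultimately have "(F has_derivative
        (\<lambda>r. ?D (p + s *\<^sub>R u + h *\<^sub>R v) (r *\<^sub>R u) - ?D (p + s *\<^sub>R u) (r *\<^sub>R u))) (at s)"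
      unfolding F_def by (rule has_derivative_diff)
    then show ?thesis
      unfolding has_field_derivative_def
      by (rule has_derivative_eq_rhs)
        (simp add: linear_cmul[OF lin(1)[OF inU(1)]] linear_cmul[OF lin(1)[OF inU(2)]] right_diff_distrib mult.commute fun_eq_iff)
  qed
  have "\<exists>s>0. s < h \<and> F h - F 0 = (h - 0) * (?D (p + s *\<^sub>R u + h *\<^sub>R v) u - ?D (p + s *\<^sub>R u) u)"
    by (rule MVT2[OF h F])
  then obtain s where s: "0 < s" "s < h"
    "F h - F 0 = (h - 0) * (?D (p + s *\<^sub>R u + h *\<^sub>R v) u - ?D (p + s *\<^sub>R u) u)"
    by blast
  have G: "((\<lambda>t. ?D (p + s *\<^sub>R u + t *\<^sub>R v) u) has_real_derivative ?DD (p + s *\<^sub>R u + t *\<^sub>R v) v) (at t)"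
    if "0 \<le> t" "t \<le> h" for t
  proof -
    have inU: "p + s *\<^sub>R u + t *\<^sub>R v \<in> U" using seg[of s t] s that by auto
    have "((\<lambda>t. p + s *\<^sub>R u + t *\<^sub>R v) has_derivative (\<lambda>t. t *\<^sub>R v)) (at t)"
      by (auto intro!: derivative_eq_intros)
    from has_derivative_compose[OF this fdd[OF inU]] show ?thesis
      unfolding has_field_derivative_def
      by (rule has_derivative_eq_rhs) (simp add: linear_cmul[OF lin(2)[OF inU]] mult.commute fun_eq_iff)
  qed
  have "\<exists>t>0. t < h \<and> ?D (p + s *\<^sub>R u + h *\<^sub>R v) u - ?D (p + s *\<^sub>R u + 0 *\<^sub>R v) u
    = (h - 0) * ?DD (p + s *\<^sub>R u + t *\<^sub>R v) v"
    by (rule MVT2[OF h G])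
  then obtain t where t: "0 < t" "t < h"
    "?D (p + s *\<^sub>R u + h *\<^sub>R v) u - ?D (p + s *\<^sub>R u + 0 *\<^sub>R v) u = (h - 0) * ?DD (p + s *\<^sub>R u + t *\<^sub>R v) v"
    by blast
  show ?thesis
    by (rule exI[of _ s], rule exI[of _ t]) (use s t in \<open>auto simp: F_def\<close>)
qed

lemma second_derivative_symmetric_real:
  fixes f :: "'a::euclidean_space \<Rightarrow> real"
  assumes U: "open U" and f: "smooth_on U f" and p: "p \<in> U"
  shows "frechet_derivative (\<lambda>x. frechet_derivative f (at x) u) (at p) v
    = frechet_derivative (\<lambda>x. frechet_derivative f (at x) v) (at p) u"
proof -
  define D where "D u v x = frechet_derivative (\<lambda>x. frechet_derivative f (at x) u) (at x) v" for u v x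
  have *: "\<bar>D u v p - D v u p\<bar> < e" if e: "e > 0" for e
  proof -
    have cont: "isCont (D u v) p" for u v
      using smooth_on_imp_continuous_on[OF smooth_on_frechet_derivative[OF smooth_on_frechet_derivative[OF f]]]
        U p unfolding D_def by (simp add: continuous_on_eq_continuous_at)
    obtain d1 where d1: "d1 > 0" "\<And>x. dist x p < d1 \<Longrightarrow> dist (D u v x) (D u v p) < e / 2"
      using cont[of u v] e unfolding continuous_at_eps_delta by (meson half_gt_zero)
    obtain d2 where d2: "d2 > 0" "\<And>x. dist x p < d2 \<Longrightarrow> dist (D v u x) (D v u p) < e / 2"
      using cont[of v u] e unfolding continuous_at_eps_delta by (meson half_gt_zero)
    obtain d3 where d3: "d3 > 0" "ball p d3 \<subseteq> U" using U p open_contains_ball by blast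
    define d where "d = min d1 (min d2 d3)"
    \<comment> \<open>This size keeps the whole parallelogram with sides \<open>h u\<close>,
      \<open>h v\<close> within distance \<open>d\<close> of \<open>p\<close>; the summand 1 keeps
      the denominator positive when both vectors vanish.\<close>
    define h where "h = d / (2 * (norm u + norm v + 1))"
    have "d > 0" using d1 d2 d3 by (simp add: d_def)
    have n: "norm u + norm v + 1 > 0" by (simp add: add_nonneg_pos)
    have h: "h > 0" using \<open>d > 0\<close> n by (simp add: h_def)
    have near: "dist (p + s *\<^sub>R u + t *\<^sub>R v) p < d" if "0 \<le> s" "s \<le> h" "0 \<le> t" "t \<le> h" for s t
    proof -
      have "dist (p + s *\<^sub>R u + t *\<^sub>R v) p \<le> s * norm u + t * norm v"
        using that norm_triangle_ineq[of "s *\<^sub>R u" "t *\<^sub>R v"] by (simp add: dist_norm add.assoc)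
      also have "\<dots> \<le> h * norm u + h * norm v"
        using that by (intro add_mono mult_right_mono) auto
      also have "\<dots> < 2 * (norm u + norm v + 1) * h"
        using h n by (simp add: algebra_simps add_nonneg_pos)
      also have "\<dots> = d" using n by (simp add: h_def)
      finally show ?thesis .
    qed
    have near': "dist (p + s *\<^sub>R v + t *\<^sub>R u) p < d" if "0 \<le> s" "s \<le> h" "0 \<le> t" "t \<le> h" for s t
      using near[of t s] that by (simp add: add.commute add.left_commute)
    have sub: "x \<in> U" if "dist x p < d" for x
      using that d3 by (auto simp: d_def dist_commute)
    obtain s t where st: "0 < s" "s < h" "0 < t" "t < h"
      "f (p + h *\<^sub>R u + h *\<^sub>R v) - f (p + h *\<^sub>R u) - f (p + h *\<^sub>R v) + f p
        = h * h * D u v (p + s *\<^sub>R u + t *\<^sub>R v)"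
      using second_difference_mean_value[OF f _ h, of p u v] near sub unfolding D_def by blast
    obtain s' t' where st': "0 < s'" "s' < h" "0 < t'" "t' < h"
      "f (p + h *\<^sub>R v + h *\<^sub>R u) - f (p + h *\<^sub>R v) - f (p + h *\<^sub>R u) + f p
        = h * h * D v u (p + s' *\<^sub>R v + t' *\<^sub>R u)"
      using second_difference_mean_value[OF f _ h, of p v u] near' sub unfolding D_def by blast
    \<comment> \<open>The second difference does not change when \<open>u\<close> and
      \<open>v\<close> are exchanged, so the two mean values of the mixed derivatives
      coincide.\<close>
    have "f (p + h *\<^sub>R v + h *\<^sub>R u) = f (p + h *\<^sub>R u + h *\<^sub>R v)" by (simp add: add_ac)
    then have "h * h * D u v (p + s *\<^sub>R u + t *\<^sub>R v) = h * h * D v u (p + s' *\<^sub>R v + t' *\<^sub>R u)"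
      using st(5) st'(5) by linarith
    then have "D u v (p + s *\<^sub>R u + t *\<^sub>R v) = D v u (p + s' *\<^sub>R v + t' *\<^sub>R u)"
      using h by simp
    moreover have "dist (D u v (p + s *\<^sub>R u + t *\<^sub>R v)) (D u v p) < e / 2"
      using near[of s t] st by (intro d1) (simp add: d_def)
    moreover have "dist (D v u (p + s' *\<^sub>R v + t' *\<^sub>R u)) (D v u p) < e / 2"
      using near'[of s' t'] st' by (intro d2) (simp add: d_def)
    ultimately show ?thesis by (simp add: dist_real_def abs_if split: if_splits)
  qed
  have "D u v p = D v u p"
  proof (rule ccontr)
    assume "D u v p \<noteq> D v u p"
    then have "\<bar>D u v p - D v u p\<bar> > 0" by simp
    from *[OF this] show False by simp
  qed
  then show ?thesis by (simp add: D_def)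
qed

lemma frechet_derivative_bounded_linear_compose:
  assumes "bounded_linear h" "f differentiable at x"
  shows "frechet_derivative (\<lambda>x. h (f x)) (at x) v = h (frechet_derivative f (at x) v)"
  using bounded_linear.has_derivative[OF assms(1) assms(2)[unfolded frechet_derivative_works]]
  by (metis frechet_derivative_at)

text \<open>Pairing with a fixed vector commutes with differentiation and reduces the claim to real
  functions; testing against the difference of the two sides finishes. The complex numbers are
  covered as a real inner product space.\<close>

lemma second_derivative_symmetric:
  fixes f :: "'a::euclidean_space \<Rightarrow> 'b::real_inner"
  assumes U: "open U" and f: "smooth_on U f" and p: "p \<in> U"
  shows "frechet_derivative (\<lambda>x. frechet_derivative f (at x) u) (at p) v
    = frechet_derivative (\<lambda>x. frechet_derivative f (at x) v) (at p) u"
    (is "?a = ?b")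
proof -
  have *: "frechet_derivative (\<lambda>x. frechet_derivative (\<lambda>x. f x \<bullet> w) (at x) u) (at p) v
    = frechet_derivative (\<lambda>x. frechet_derivative f (at x) u) (at p) v \<bullet> w" for u v w
  proof -
    have "frechet_derivative (\<lambda>x. frechet_derivative (\<lambda>x. f x \<bullet> w) (at x) u) (at p)
      = frechet_derivative (\<lambda>x. frechet_derivative f (at x) u \<bullet> w) (at p)"
    proof (rule frechet_derivative_transform_within_open[OF _ U p])
      have "smooth_on U (\<lambda>x. f x \<bullet> w)"
        using U f by (rule smooth_on_bounded_linear_compose[OF _ bounded_linear_inner_left])
      then show "(\<lambda>x. frechet_derivative (\<lambda>x. f x \<bullet> w) (at x) u) differentiable at p"
        by (rule smooth_on_imp_differentiable[OF smooth_on_frechet_derivative p])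
    qed (use f in \<open>simp add: frechet_derivative_bounded_linear_compose[OF bounded_linear_inner_left]
          smooth_on_imp_differentiable\<close>)
    then have "frechet_derivative (\<lambda>x. frechet_derivative (\<lambda>x. f x \<bullet> w) (at x) u) (at p) v
      = frechet_derivative (\<lambda>x. frechet_derivative f (at x) u \<bullet> w) (at p) v" by simp
    also have "\<dots> = frechet_derivative (\<lambda>x. frechet_derivative f (at x) u) (at p) v \<bullet> w"
      by (rule frechet_derivative_bounded_linear_compose[OF bounded_linear_inner_left
            smooth_on_imp_differentiable[OF smooth_on_frechet_derivative[OF f] p]])
    finally show ?thesis .
  qed
  have "?a \<bullet> w = ?b \<bullet> w" for w
    using second_derivative_symmetric_real[OF U
        smooth_on_bounded_linear_compose[OF U bounded_linear_inner_left f] p, of w u v]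
    by (simp add: *)
  from this[of "?a - ?b"] have "(?a - ?b) \<bullet> (?a - ?b) = 0" by (simp only: inner_diff_left)
  then show ?thesis by simp
qed

subsection \<open>Wirtinger derivatives and the complexified coordinate frame\<close>

lemma frechet_derivative_mult:
  fixes f g :: "'a::real_normed_vector \<Rightarrow> complex"
  assumes "f differentiable at x" "g differentiable at x"
  shows "frechet_derivative (\<lambda>x. f x * g x) (at x) v
    = frechet_derivative f (at x) v * g x + f x * frechet_derivative g (at x) v"
  using has_derivative_mult[OF assms[unfolded frechet_derivative_works]]
  by (simp flip: frechet_derivative_at)

lemma frechet_derivative_sum:
  assumes "\<And>i. i \<in> I \<Longrightarrow> f i differentiable at x"
  shows "frechet_derivative (\<lambda>x. \<Sum>i\<in>I. f i x) (at x) v = (\<Sum>i\<in>I. frechet_derivative (f i) (at x) v)"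
proof -
  have "((\<lambda>x. \<Sum>i\<in>I. f i x) has_derivative (\<lambda>v. \<Sum>i\<in>I. frechet_derivative (f i) (at x) v)) (at x)"
    using assms by (intro has_derivative_sum) (simp flip: frechet_derivative_works)
  from frechet_derivative_at[OF this] show ?thesis by metis
qed

lemma wirt_mult:
  assumes "f differentiable at x" "g differentiable at x"
  shows "wirt u v (\<lambda>x. f x * g x) x = wirt u v f x * g x + f x * wirt u v g x"
    and "wirt_cnj u v (\<lambda>x. f x * g x) x = wirt_cnj u v f x * g x + f x * wirt_cnj u v g x"
  by (simp_all add: wirt_def wirt_cnj_def frechet_derivative_mult[OF assms] algebra_simps add_divide_distrib diff_divide_distrib)

lemma wirt_sum:
  assumes "\<And>i. i \<in> I \<Longrightarrow> f i differentiable at x"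
  shows "wirt u v (\<lambda>x. \<Sum>i\<in>I. f i x) x = (\<Sum>i\<in>I. wirt u v (f i) x)"
    and "wirt_cnj u v (\<lambda>x. \<Sum>i\<in>I. f i x) x = (\<Sum>i\<in>I. wirt_cnj u v (f i) x)"
  by (simp_all only: wirt_def wirt_cnj_def frechet_derivative_sum[OF assms] sum_divide_distrib
      sum_subtractf sum.distrib sum_distrib_left diff_divide_distrib add_divide_distrib)

lemma wirt_cong_open:
  assumes "open U" "y \<in> U" "f differentiable at y" "\<And>z. z \<in> U \<Longrightarrow> f z = f' z"
  shows "wirt u v f y = wirt u v f' y" "wirt_cnj u v f y = wirt_cnj u v f' y"
  using frechet_derivative_transform_within_open[OF assms(3,1,2,4)]
  by (simp_all add: wirt_def wirt_cnj_def)

lemma pd_mult: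
  assumes "f differentiable at p" "g differentiable at p"
  shows "pd k (\<lambda>x. f x * g x) p = pd k f p * g p + f p * pd k g p"
  by (cases k) (simp_all add: frechet_derivative_mult[OF assms] wirt_mult[OF assms])

lemma pd_sum:
  assumes "\<And>i. i \<in> I \<Longrightarrow> f i differentiable at p"
  shows "pd k (\<lambda>x. \<Sum>i\<in>I. f i x) p = (\<Sum>i\<in>I. pd k (f i) p)"
  by (cases k) (simp_all add: frechet_derivative_sum[OF assms] wirt_sum[OF assms])

lemma pd_const [simp]: "pd k (\<lambda>x. c) p = 0"
  by (cases k) (simp_all add: wirt_def wirt_cnj_def)

lemma pd_cong_open:
  assumes "open U" "p \<in> U" "f differentiable at p" "\<And>q. q \<in> U \<Longrightarrow> f q = g q"
  shows "pd k f p = pd k g p"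
  using frechet_derivative_transform_within_open[OF assms(3,1,2,4)]
  by (cases k) (simp_all add: wirt_def wirt_cnj_def)

lemma smooth_on_pd:
  assumes "open U" "smooth_on U f"
  shows "smooth_on U (\<lambda>p. pd k f p)"
proof -
  have "smooth_on U (\<lambda>p. (frechet_derivative f (at p) u + c * frechet_derivative f (at p) v) / 2)" for u v c
    using assms
    by (intro smooth_on_divide smooth_on_add smooth_on_mult smooth_on_const smooth_on_frechet_derivative) auto
  from this[of _ \<i>] this[of _ "-\<i>"] show ?thesis
    by (cases k) (simp_all add: wirt_def wirt_cnj_def smooth_on_frechet_derivative[OF assms(2)])
qed

section \<open>Complexified components of real tangent vectors\<close>

lemma sum_UNIV_coord: "(\<Sum>k\<in>UNIV. f k) = f CZ + f CW + f CWc + f CR + f Cs + f Csc"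
  for f :: "coord \<Rightarrow> 'a::comm_monoid_add"
  by (simp add: UNIV_coord add.assoc)

lemma sum_UNIV_tet: "(\<Sum>k\<in>UNIV. f k) = f T0 + f Tp + f Tm + f T1"
  for f :: "tet \<Rightarrow> 'a::comm_monoid_add"
  by (simp add: UNIV_tet add.assoc)

lemma bounded_linear_jet:
  "bounded_linear jZ" "bounded_linear jW" "bounded_linear jR" "bounded_linear js"
  unfolding jZ_def[abs_def] jW_def[abs_def] jR_def[abs_def] js_def[abs_def]
  by (intro bounded_linear_fst bounded_linear_snd bounded_linear_compose[OF bounded_linear_fst]
      bounded_linear_compose[OF bounded_linear_snd] bounded_linear_ident)+

lemma bounded_linear_coord_fun: "bounded_linear (coord_fun k)"
proof -
  have "coord_fun CZ = (\<lambda>p. of_real (jZ p))" "coord_fun CW = jW" "coord_fun CWc = (\<lambda>p. cnj (jW p))"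
    "coord_fun CR = (\<lambda>p. of_real (jR p))" "coord_fun Cs = js" "coord_fun Csc = (\<lambda>p. cnj (js p))"
    by auto
  then show ?thesis
    by (cases k)
      (auto simp: bounded_linear_jet intro!: bounded_linear_compose[OF bounded_linear_of_real]
        bounded_linear_compose[OF bounded_linear_cnj])
qed

text \<open>This is \<open>df = \<Sum> dx\<^sup>k \<partial>\<^sub>k f\<close> in the complexified
  frame. For a complex coordinate \<open>w\<close>, the Wirtinger normalisation makes the sum of the
  \<open>w\<close> and \<open>w\<^sup>*\<close> terms equal to the real and imaginary directional
  derivatives weighted by \<open>Re w\<close> and \<open>Im w\<close>.\<close>

lemma frechet_derivative_eq_pd:
  assumes "f differentiable at p"
  shows "frechet_derivative f (at p) v = (\<Sum>k\<in>UNIV. coord_fun k v * pd k f p)"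
proof -
  let ?L = "frechet_derivative f (at p)"
  have lin: "linear ?L" by (rule linear_frechet_derivative[OF assms])
  obtain z w r s where v: "v = (z, w, r, s)" by (metis prod.collapse)
  have "v = z *\<^sub>R (1, 0, 0, 0) + Re w *\<^sub>R (0, 1, 0, 0) + Im w *\<^sub>R (0, \<i>, 0, 0)
    + r *\<^sub>R (0, 0, 1, 0) + Re s *\<^sub>R (0, 0, 0, 1) + Im s *\<^sub>R (0, 0, 0, \<i>)"
    by (simp add: v complex_eq_iff)
  then have "?L v = z *\<^sub>R ?L (1, 0, 0, 0) + Re w *\<^sub>R ?L (0, 1, 0, 0) + Im w *\<^sub>R ?L (0, \<i>, 0, 0)
    + r *\<^sub>R ?L (0, 0, 1, 0) + Re s *\<^sub>R ?L (0, 0, 0, 1) + Im s *\<^sub>R ?L (0, 0, 0, \<i>)"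
    by (simp only: linear_add[OF lin] linear_cmul[OF lin])
  moreover have "jZ v = z" "jW v = w" "jR v = r" "js v = s"
    by (simp_all add: v jZ_def jW_def jR_def js_def)
  ultimately show ?thesis
    by (simp add: sum_UNIV_coord wirt_def wirt_cnj_def complex_eq_iff field_simps)
qed

text \<open>Real vectors span the complexified tangent space: the values at 1 and at \<i> separate
  the coefficients of a coordinate and of its conjugate. This recovers the components of a form from
  its values on real vectors.\<close>

lemma coord_fun_functional_eq_0:
  assumes "\<And>v. (\<Sum>k\<in>UNIV. c k * coord_fun k v) = 0"
  shows "c k = 0"
proof -
  have *: "c CZ * of_real z + c CW * w + c CWc * cnj w + c CR * of_real r + c Cs * s + c Csc * cnj s = 0"
    for z w r s
    using assms[of "(z, w, r, s)"] by (simp add: sum_UNIV_coord jZ_def jW_def jR_def js_def)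
  have "c CW = 0 \<and> c CWc = 0"
    using *[of 0 1 0 0] *[of 0 \<i> 0 0] by (auto simp: complex_eq_iff)
  moreover have "c Cs = 0 \<and> c Csc = 0"
    using *[of 0 0 0 1] *[of 0 0 0 \<i>] by (auto simp: complex_eq_iff)
  moreover have "c CZ = 0" "c CR = 0" using *[of 1 0 0 0] *[of 0 0 1 0] by auto
  ultimately show ?thesis by (cases k) auto
qed

lemma frechet_derivative_coord_fun_compose:
  assumes "\<phi> differentiable at y"
  shows "frechet_derivative (\<lambda>z. coord_fun k (\<phi> z)) (at y) v = coord_fun k (frechet_derivative \<phi> (at y) v)"
  by (rule frechet_derivative_bounded_linear_compose[OF bounded_linear_coord_fun assms])

lemma frechet_derivative_chain_pd:
  assumes "\<phi> differentiable at y" "f differentiable at (\<phi> y)"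
  shows "frechet_derivative (\<lambda>z. f (\<phi> z)) (at y) v
    = (\<Sum>k\<in>UNIV. frechet_derivative (\<lambda>z. coord_fun k (\<phi> z)) (at y) v * pd k f (\<phi> y))"
  using frechet_derivative_compose[OF assms] frechet_derivative_eq_pd[OF assms(2)]
  by (simp add: o_def frechet_derivative_coord_fun_compose[OF assms(1)])

lemma wirt_chain_pd:
  assumes "\<phi> differentiable at y" "f differentiable at (\<phi> y)"
  shows "wirt u v (\<lambda>z. f (\<phi> z)) y = (\<Sum>k\<in>UNIV. wirt u v (\<lambda>z. coord_fun k (\<phi> z)) y * pd k f (\<phi> y))"
    and "wirt_cnj u v (\<lambda>z. f (\<phi> z)) y = (\<Sum>k\<in>UNIV. wirt_cnj u v (\<lambda>z. coord_fun k (\<phi> z)) y * pd k f (\<phi> y))"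
  by (simp_all add: wirt_def wirt_cnj_def frechet_derivative_chain_pd[OF assms] sum_UNIV_coord field_simps)

text \<open>A Wirtinger derivative is a combination of two directional derivatives with constant
  coefficients, so it inherits the symmetry of second derivatives. In the chart this expresses that
  \<open>\<partial>\<^sub>s\<close> and \<open>\<partial>\<^sub>k\<close> commute.\<close>

lemma wirt_frechet_derivative_commute:
  assumes "open Y" "smooth_on Y F" "y \<in> Y"
  shows "wirt u v (\<lambda>z. frechet_derivative F (at z) w) y = frechet_derivative (\<lambda>z. wirt u v F z) (at y) w"
    and "wirt_cnj u v (\<lambda>z. frechet_derivative F (at z) w) y = frechet_derivative (\<lambda>z. wirt_cnj u v F z) (at y) w"
proof -
  have D: "((\<lambda>z. frechet_derivative F (at z) u) has_derivative
      frechet_derivative (\<lambda>z. frechet_derivative F (at z) u) (at y)) (at y)" for u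
    by (rule smooth_on_has_derivative[OF smooth_on_frechet_derivative[OF assms(2)] assms(3)])
  have "((\<lambda>z. (frechet_derivative F (at z) u + c * frechet_derivative F (at z) v) / 2) has_derivative
      (\<lambda>w. (frechet_derivative (\<lambda>z. frechet_derivative F (at z) u) (at y) w
        + c * frechet_derivative (\<lambda>z. frechet_derivative F (at z) v) (at y) w) / 2)) (at y)" for c
    by (rule derivative_eq_intros D refl | simp)+
  from this[of \<i>, THEN frechet_derivative_at] this[of "-\<i>", THEN frechet_derivative_at]
  show "wirt u v (\<lambda>z. frechet_derivative F (at z) w) y = frechet_derivative (\<lambda>z. wirt u v F z) (at y) w"
    and "wirt_cnj u v (\<lambda>z. frechet_derivative F (at z) w) y = frechet_derivative (\<lambda>z. wirt_cnj u v F z) (at y) w"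
    using second_derivative_symmetric[OF assms, of w] by (simp_all add: wirt_def wirt_cnj_def fun_eq_iff)
qed

subsection \<open>The Lie derivative of the metric\<close>

text \<open>In \<open>L \<theta> = i(X) d\<theta> + d(\<theta>(X))\<close> the last term vanishes,
  and the torsion equation replaces \<open>d\<theta>\<close>. The annihilation hypothesis is imposed
  on all of \<open>U\<close>, not just at \<open>p\<close>, because it gets differentiated.\<close>

lemma lie_deriv_tetrad_form:
  fixes \<theta> :: "tet \<Rightarrow> form1"
  assumes U: "open U" "p \<in> U"
    and X: "\<And>k. (\<lambda>q. X q k) differentiable at p"
    and \<theta>: "\<And>i m. (\<lambda>q. \<theta> i q m) differentiable at p"
    and ann: "\<And>q i. q \<in> U \<Longrightarrow> (\<Sum>k\<in>UNIV. \<theta> i q k * X q k) = 0"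
    and torsion: "\<And>i m n. ext_d (\<theta> i) p m n
        + (\<Sum>k\<in>UNIV. \<Sum>j\<in>UNIV. eta i k * wedge (\<omega> k j) (\<theta> j) p m n) = 0"
  shows "(\<Sum>k\<in>UNIV. X p k * pd k (\<lambda>q. \<theta> i q m) p + \<theta> i p k * pd m (\<lambda>q. X q k) p)
    = - (\<Sum>k\<in>UNIV. \<Sum>j\<in>UNIV. eta i k * (\<Sum>l\<in>UNIV. X p l * \<omega> k j p l) * \<theta> j p m)"
proof -
  \<comment> \<open>Contracting \<open>\<omega> \<and> \<theta>\<close> with \<open>X\<close> gives
    two terms; the one containing \<open>\<theta>\<^sup>j(X)\<close> drops out.\<close>
  have *: "(\<Sum>l\<in>UNIV. eta i k * (X p l * wedge (\<omega> k j) (\<theta> j) p l m))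
    = eta i k * (\<Sum>l\<in>UNIV. X p l * \<omega> k j p l) * \<theta> j p m" for k j
  proof -
    have "(\<Sum>l\<in>UNIV. eta i k * (X p l * wedge (\<omega> k j) (\<theta> j) p l m))
      = eta i k * (\<Sum>l\<in>UNIV. X p l * \<omega> k j p l) * \<theta> j p m
        - eta i k * \<omega> k j p m * (\<Sum>l\<in>UNIV. \<theta> j p l * X p l)"
      by (simp add: wedge_def sum_distrib_left sum_distrib_right sum_subtractf algebra_simps)
    then show ?thesis using ann[OF U(2)] by simp
  qed
  \<comment> \<open>Differentiating \<open>\<theta>(X) = 0\<close> trades the derivatives of
    \<open>X\<close> in the Lie derivative for derivatives of \<open>\<theta>\<close>, which
    antisymmetrise the remaining term to \<open>d\<theta>\<close>.\<close>
  have "pd m (\<lambda>q. \<Sum>k\<in>UNIV. \<theta> i q k * X q k) p = pd m (\<lambda>q. 0) p"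
    by (rule pd_cong_open[OF U]) (auto simp: ann intro!: differentiable_sum differentiable_mult X \<theta>)
  then have "(\<Sum>k\<in>UNIV. pd m (\<lambda>q. \<theta> i q k) p * X p k + \<theta> i p k * pd m (\<lambda>q. X q k) p) = 0"
    by (simp add: pd_sum pd_mult X \<theta>)
  then have "(\<Sum>k\<in>UNIV. X p k * pd k (\<lambda>q. \<theta> i q m) p + \<theta> i p k * pd m (\<lambda>q. X q k) p)
    = (\<Sum>k\<in>UNIV. X p k * ext_d (\<theta> i) p k m)"
    by (simp add: ext_d_def sum.distrib sum_subtractf algebra_simps)
  also have "\<dots> = (\<Sum>l\<in>UNIV. X p l * - (\<Sum>k\<in>UNIV. \<Sum>j\<in>UNIV. eta i k * wedge (\<omega> k j) (\<theta> j) p l m))"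
    using torsion by (simp only: eq_neg_iff_add_eq_0[symmetric])
  also have "\<dots> = - (\<Sum>k\<in>UNIV. \<Sum>j\<in>UNIV. \<Sum>l\<in>UNIV. eta i k * (X p l * wedge (\<omega> k j) (\<theta> j) p l m))"
    by (simp add: sum_distrib_left sum_negf sum.swap[of _ "UNIV :: coord set"] ac_simps)
  also have "\<dots> = - (\<Sum>k\<in>UNIV. \<Sum>j\<in>UNIV. eta i k * (\<Sum>l\<in>UNIV. X p l * \<omega> k j p l) * \<theta> j p m)"
    by (simp only: *)
  finally show ?thesis .
qed

lemma lie_deriv_tetrad_metric:
  fixes \<theta> :: "tet \<Rightarrow> form1"
  assumes U: "open U" "p \<in> U"
    and X: "\<And>k. (\<lambda>q. X q k) differentiable at p"
    and \<theta>: "\<And>i m. (\<lambda>q. \<theta> i q m) differentiable at p"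
    and ann: "\<And>q i. q \<in> U \<Longrightarrow> (\<Sum>k\<in>UNIV. \<theta> i q k * X q k) = 0"
    and torsion: "\<And>i m n. ext_d (\<theta> i) p m n
        + (\<Sum>k\<in>UNIV. \<Sum>j\<in>UNIV. eta i k * wedge (\<omega> k j) (\<theta> j) p m n) = 0"
    and weyl: "\<And>i j m. \<omega> i j p m = (\<omega> i j p m - \<omega> j i p m) / 2 + eta i j * A p m"
  shows "lie_deriv X (tetrad_metric \<theta>) p m n
    = - 2 * (\<Sum>k\<in>UNIV. X p k * A p k) * tetrad_metric \<theta> p m n"
proof -
  define L where "L i m = (\<Sum>k\<in>UNIV. X p k * pd k (\<lambda>q. \<theta> i q m) p + \<theta> i p k * pd m (\<lambda>q. X q k) p)" for i m
  define w where "w i j = (\<Sum>l\<in>UNIV. X p l * \<omega> i j p l)" for i j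
  define a where "a = (\<Sum>k\<in>UNIV. X p k * A p k)"
  have pdg: "pd k (\<lambda>q. tetrad_metric \<theta> q m n) p = (\<Sum>i\<in>UNIV. \<Sum>j\<in>UNIV.
      eta i j * (pd k (\<lambda>q. \<theta> i q m) p * \<theta> j p n + \<theta> i p m * pd k (\<lambda>q. \<theta> j q n) p))" for k
    by (simp add: tetrad_metric_def pd_sum pd_mult X \<theta> differentiable_mult differentiable_sum algebra_simps)
  have "X p k * pd k (\<lambda>q. tetrad_metric \<theta> q m n) p + tetrad_metric \<theta> p k n * pd m (\<lambda>q. X q k) p
      + tetrad_metric \<theta> p m k * pd n (\<lambda>q. X q k) p
    = (\<Sum>i\<in>UNIV. \<Sum>j\<in>UNIV. eta i j *
        ((X p k * pd k (\<lambda>q. \<theta> i q m) p + \<theta> i p k * pd m (\<lambda>q. X q k) p) * \<theta> j p n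
        + \<theta> i p m * (X p k * pd k (\<lambda>q. \<theta> j q n) p + \<theta> j p k * pd n (\<lambda>q. X q k) p)))" for k
    unfolding pdg unfolding tetrad_metric_def by (simp add: sum_distrib_left sum_distrib_right sum.distrib algebra_simps)
  then have "lie_deriv X (tetrad_metric \<theta>) p m n
    = (\<Sum>i\<in>UNIV. \<Sum>j\<in>UNIV. \<Sum>k\<in>UNIV. eta i j *
        ((X p k * pd k (\<lambda>q. \<theta> i q m) p + \<theta> i p k * pd m (\<lambda>q. X q k) p) * \<theta> j p n
        + \<theta> i p m * (X p k * pd k (\<lambda>q. \<theta> j q n) p + \<theta> j p k * pd n (\<lambda>q. X q k) p)))"
    by (simp add: lie_deriv_def sum.swap[of _ "UNIV :: coord set"])
  also have "\<dots> = (\<Sum>i\<in>UNIV. \<Sum>j\<in>UNIV. eta i j * (L i m * \<theta> j p n + \<theta> i p m * L j n))"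
    by (simp only: L_def sum.distrib sum_distrib_left[symmetric] sum_distrib_right[symmetric])
  also have "\<dots> = - 2 * a * tetrad_metric \<theta> p m n"
  proof -
    have "L i m = - (\<Sum>k\<in>UNIV. \<Sum>j\<in>UNIV. eta i k * w k j * \<theta> j p m)" for i m
      unfolding L_def w_def by (rule lie_deriv_tetrad_form[OF U X \<theta> ann torsion])
    \<comment> \<open>Raising the first index of \<open>w\<close> with \<open>eta\<close> exchanges
      0 with 1, and \<open>+\<close> with \<open>-\<close> at the cost of a sign.\<close>
    then have L: "L T0 m = - (\<Sum>j\<in>UNIV. w T1 j * \<theta> j p m)" "L T1 m = - (\<Sum>j\<in>UNIV. w T0 j * \<theta> j p m)"
      "L Tp m = (\<Sum>j\<in>UNIV. w Tm j * \<theta> j p m)" "L Tm m = (\<Sum>j\<in>UNIV. w Tp j * \<theta> j p m)" for m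
      by (simp_all add: sum_UNIV_tet eta_def)
    \<comment> \<open>The Weyl condition prescribes exactly the symmetric part of the connection;
      contraction with \<open>X\<close> turns \<open>A\<close> into the number
      \<open>a\<close>.\<close>
    have "w i j + w j i = 2 * eta i j * a" for i j
    proof -
      have "\<omega> i j p m + \<omega> j i p m = 2 * eta i j * A p m" for m
        using weyl[of i j m] by (simp add: field_simps)
      then have "X p l * \<omega> i j p l + X p l * \<omega> j i p l = 2 * eta i j * (X p l * A p l)" for l
        by (metis (no_types, lifting) distrib_left mult.left_commute)
      then show ?thesis by (simp add: w_def a_def sum_distrib_left flip: sum.distrib)
    qed
    then have w: "w j i = 2 * eta i j * a - w i j" for i j by (metis add_diff_cancel_left')
    \<comment> \<open>The diagonal of \<open>eta\<close> is zero, so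
      \<open>2 w\<^sub>i\<^sub>i = 0\<close>. The remaining entries are eliminated in pairs, and all
      antisymmetric contributions cancel.\<close>
    have "w T0 T0 = 0" "w T1 T1 = 0" "w Tp Tp = 0" "w Tm Tm = 0"
      using w[of T0 T0] w[of T1 T1] w[of Tp Tp] w[of Tm Tm] by (simp_all add: eta_def)
    then show ?thesis
      by (simp add: tetrad_metric_def sum_UNIV_tet eta_def L w[of T0 T1] w[of T0 Tp] w[of T0 Tm] w[of Tp Tm] w[of Tp T1] w[of Tm T1])
        (simp add: algebra_simps)
  qed
  finally show ?thesis by (simp add: a_def)
qed

text \<open>The left side is the product rule for the derivative of \<open>g(P, Q)\<close> along
  \<open>X\<close> when \<open>P\<close> and \<open>Q\<close> commute with \<open>X\<close>, that
  is, when the component \<open>m\<close> of \<open>P\<close> changes at the rate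
  \<open>P(X\<^sup>m)\<close>. Renaming summation indices collects the terms into the Lie
  derivative.\<close>

lemma lie_deriv_contracted:
  fixes P Q :: "coord \<Rightarrow> complex"
  shows "(\<Sum>m\<in>UNIV. \<Sum>n\<in>UNIV. (\<Sum>j\<in>UNIV. X p j * pd j (\<lambda>q. g q m n) p) * P m * Q n
      + g p m n * (\<Sum>j\<in>UNIV. P j * pd j (\<lambda>q. X q m) p) * Q n
      + g p m n * P m * (\<Sum>j\<in>UNIV. Q j * pd j (\<lambda>q. X q n) p))
    = (\<Sum>m\<in>UNIV. \<Sum>n\<in>UNIV. lie_deriv X g p m n * P m * Q n)"
proof -
  have 1: "(\<Sum>m\<in>UNIV. \<Sum>n\<in>UNIV. g p m n * (\<Sum>j\<in>UNIV. P j * pd j (\<lambda>q. X q m) p) * Q n)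
    = (\<Sum>m\<in>UNIV. \<Sum>n\<in>UNIV. (\<Sum>j\<in>UNIV. g p j n * pd m (\<lambda>q. X q j) p) * P m * Q n)"
  proof -
    have "(\<Sum>m\<in>UNIV. \<Sum>n\<in>UNIV. g p m n * (\<Sum>j\<in>UNIV. P j * pd j (\<lambda>q. X q m) p) * Q n)
      = (\<Sum>n\<in>UNIV. \<Sum>m\<in>UNIV. \<Sum>j\<in>UNIV. g p m n * P j * pd j (\<lambda>q. X q m) p * Q n)"
      by (subst sum.swap) (simp add: sum_distrib_left sum_distrib_right mult_ac)
    also have "\<dots> = (\<Sum>n\<in>UNIV. \<Sum>j\<in>UNIV. \<Sum>m\<in>UNIV. g p m n * P j * pd j (\<lambda>q. X q m) p * Q n)"
      by (intro sum.cong refl sum.swap)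
    also have "\<dots> = (\<Sum>j\<in>UNIV. \<Sum>n\<in>UNIV. \<Sum>m\<in>UNIV. g p m n * P j * pd j (\<lambda>q. X q m) p * Q n)"
      by (rule sum.swap)
    finally show ?thesis by (simp add: sum_distrib_left sum_distrib_right mult_ac)
  qed
  have 2: "(\<Sum>m\<in>UNIV. \<Sum>n\<in>UNIV. g p m n * P m * (\<Sum>j\<in>UNIV. Q j * pd j (\<lambda>q. X q n) p))
    = (\<Sum>m\<in>UNIV. \<Sum>n\<in>UNIV. (\<Sum>j\<in>UNIV. g p m j * pd n (\<lambda>q. X q j) p) * P m * Q n)"
  proof -
    have "(\<Sum>m\<in>UNIV. \<Sum>n\<in>UNIV. g p m n * P m * (\<Sum>j\<in>UNIV. Q j * pd j (\<lambda>q. X q n) p))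
      = (\<Sum>m\<in>UNIV. \<Sum>n\<in>UNIV. \<Sum>j\<in>UNIV. g p m n * P m * Q j * pd j (\<lambda>q. X q n) p)"
      by (simp add: sum_distrib_left mult_ac)
    also have "\<dots> = (\<Sum>m\<in>UNIV. \<Sum>j\<in>UNIV. \<Sum>n\<in>UNIV. g p m n * P m * Q j * pd j (\<lambda>q. X q n) p)"
      by (intro sum.cong refl sum.swap)
    finally show ?thesis by (simp add: sum_distrib_left sum_distrib_right mult_ac)
  qed
  show ?thesis
    by (simp only: sum.distrib 1 2) (simp only: lie_deriv_def sum.distrib distrib_right)
qed

section \<open>Smoothness of the tetrad and contractions with the two vector fields\<close>

lemma smooth_on_jet:
  assumes "open U"
  shows "smooth_on U jW" "smooth_on U (\<lambda>p. complex_of_real (jR p))"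
  using assms
  by (auto intro!: smooth_on_bounded_linear smooth_on_of_real bounded_linear_jet)

lemma integrable_pde_pairD:
  assumes "integrable_pde_pair U S"
  shows "open U" "smooth_on U S" "p \<in> U \<Longrightarrow> 1 - pd CR S p * pd CR (cnjf S) p \<noteq> 0"
proof -
  show "open U" "smooth_on U S" using assms by (simp_all add: integrable_pde_pair_def)
  show "1 - pd CR S p * pd CR (cnjf S) p \<noteq> 0" if "p \<in> U"
  proof
    assume "1 - pd CR S p * pd CR (cnjf S) p = 0"
    moreover have "Re (1 - pd CR S p * pd CR (cnjf S) p) > 0"
      using assms that by (simp only: integrable_pde_pair_def)
    ultimately show False by simp
  qed
qed

lemma smooth_on_TT:
  assumes "integrable_pde_pair U S"
  shows "smooth_on U (TT S)"
  unfolding TT_def[abs_def]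
  using integrable_pde_pairD[OF assms]
  by (intro smooth_on_divide smooth_on_add smooth_on_diff smooth_on_mult smooth_on_pd smooth_on_cnj
      smooth_on_const smooth_on_jet) auto

lemma smooth_on_e_s:
  assumes "integrable_pde_pair U S"
  shows "smooth_on U (\<lambda>p. e_s S p k)" "smooth_on U (\<lambda>p. e_sc S p k)"
  using integrable_pde_pairD(1,2)[OF assms] smooth_on_TT[OF assms]
  by (cases k; simp add: smooth_on_cnj smooth_on_const smooth_on_jet)+

lemma smooth_on_theta:
  assumes "integrable_pde_pair U S" "tetrad_params U \<Phi> \<alpha> b a c"
  shows "smooth_on U (\<lambda>p. theta S \<Phi> \<alpha> b a c i p m)"
proof -
  note U = integrable_pde_pairD(1)[OF assms(1)]
  have beta: "smooth_on U (\<lambda>p. beta S i p m)" for i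
    using U integrable_pde_pairD(2)[OF assms(1)] smooth_on_TT[OF assms(1)]
    by (cases i) (auto simp: dcoord_def
        intro!: smooth_on_diff smooth_on_minus smooth_on_mult smooth_on_const smooth_on_cnj smooth_on_jet)
  show ?thesis
    using U assms(2) unfolding tetrad_params_def
    by (cases i) (auto simp del: beta.simps intro!: smooth_on_mult smooth_on_add beta smooth_on_of_real smooth_on_cnj)
qed

lemma smooth_on_tetrad_metric:
  assumes "open U" "\<And>i m. smooth_on U (\<lambda>p. \<theta> i p m)"
  shows "smooth_on U (\<lambda>p. tetrad_metric \<theta> p m n)"
  unfolding tetrad_metric_def using assms
  by (intro smooth_on_sum smooth_on_mult smooth_on_const) auto

text \<open>All contact forms \<open>beta\<close> vanish on \<open>D\<close> and its conjugate,
  hence so do their combinations. The identity holds in \<open>p\<close>, so it can be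
  differentiated.\<close>

lemma theta_e_s:
  "(\<Sum>k\<in>UNIV. theta S \<Phi> \<alpha> b a c i p k * e_s S p k) = 0"
  "(\<Sum>k\<in>UNIV. theta S \<Phi> \<alpha> b a c i p k * e_sc S p k) = 0"
  by (cases i; simp add: sum_UNIV_coord dcoord_def algebra_simps)+

text \<open>Contraction with \<open>e_s\<close> kills the tetrad part and picks out
  \<open>ds\<close>, contraction with \<open>e_sc\<close> picks out its conjugate. This identifies
  the scalar factor in the general Lie derivative formula as \<open>As\<close> or
  \<open>Asc\<close>.\<close>

lemma weyl_form_e_s:
  fixes \<theta> :: "tet \<Rightarrow> form1"
  assumes "\<And>i. (\<Sum>k\<in>UNIV. \<theta> i p k * e_s S p k) = 0" "\<And>i. (\<Sum>k\<in>UNIV. \<theta> i p k * e_sc S p k) = 0"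
  shows "(\<Sum>k\<in>UNIV. e_s S p k * weyl_form \<theta> At As Asc p k) = As p"
    and "(\<Sum>k\<in>UNIV. e_sc S p k * weyl_form \<theta> At As Asc p k) = Asc p"
proof -
  have "(\<Sum>k\<in>UNIV. X k * weyl_form \<theta> At As Asc p k) = As p * X Cs + Asc p * X Csc"
    if "\<And>i. (\<Sum>k\<in>UNIV. \<theta> i p k * X k) = 0" for X
  proof -
    have "(\<Sum>k\<in>UNIV. X k * weyl_form \<theta> At As Asc p k)
      = (\<Sum>i\<in>UNIV. At i p * (\<Sum>k\<in>UNIV. \<theta> i p k * X k)) + As p * X Cs + Asc p * X Csc"
      by (simp add: weyl_form_def sum_UNIV_coord sum_UNIV_tet dcoord_def algebra_simps)
    then show ?thesis using that by simp
  qed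
  from this[of "e_s S p"] this[of "e_sc S p"] assms
  show "(\<Sum>k\<in>UNIV. e_s S p k * weyl_form \<theta> At As Asc p k) = As p"
    and "(\<Sum>k\<in>UNIV. e_sc S p k * weyl_form \<theta> At As Asc p k) = Asc p"
    by simp_all
qed

lemma lie_deriv_tetrad_metric_e_s:
  assumes pde: "integrable_pde_pair U S" and params: "tetrad_params U \<Phi> \<alpha> b a c"
    and \<theta>: "\<theta> = theta S \<Phi> \<alpha> b a c"
    and weyl: "torsion_free_gen_weyl U \<theta> \<omega> (weyl_form \<theta> At As Asc)"
    and p: "p \<in> U"
  shows "lie_deriv (e_s S) (tetrad_metric \<theta>) p m n = - 2 * As p * tetrad_metric \<theta> p m n"
    and "lie_deriv (e_sc S) (tetrad_metric \<theta>) p m n = - 2 * Asc p * tetrad_metric \<theta> p m n"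
proof -
  note U = integrable_pde_pairD(1)[OF pde]
  have ann: "(\<Sum>k\<in>UNIV. \<theta> i q k * e_s S q k) = 0" "(\<Sum>k\<in>UNIV. \<theta> i q k * e_sc S q k) = 0" for i q
    unfolding \<theta> by (rule theta_e_s)+
  have d: "(\<lambda>q. \<theta> i q m) differentiable at p" for i m
    using smooth_on_theta[OF pde params] p unfolding \<theta> by (rule smooth_on_imp_differentiable)
  have X: "(\<lambda>q. e_s S q k) differentiable at p" "(\<lambda>q. e_sc S q k) differentiable at p" for k
    using smooth_on_e_s[OF pde] p by (auto intro: smooth_on_imp_differentiable)
  have tors: "ext_d (\<theta> i) p m n + (\<Sum>k\<in>UNIV. \<Sum>j\<in>UNIV. eta i k * wedge (\<omega> k j) (\<theta> j) p m n) = 0"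
    and w: "\<omega> i j p m = (\<omega> i j p m - \<omega> j i p m) / 2 + eta i j * weyl_form \<theta> At As Asc p m" for i j m n
    using weyl p unfolding torsion_free_gen_weyl_def by blast+
  show "lie_deriv (e_s S) (tetrad_metric \<theta>) p m n = - 2 * As p * tetrad_metric \<theta> p m n"
    using lie_deriv_tetrad_metric[where X = "e_s S" and U = U and \<omega> = \<omega>
        and \<theta> = \<theta> and A = "weyl_form \<theta> At As Asc", OF U p X(1) d ann(1) tors w] weyl_form_e_s(1)[where \<theta> = \<theta> and p = p, OF ann] by simp
  show "lie_deriv (e_sc S) (tetrad_metric \<theta>) p m n = - 2 * Asc p * tetrad_metric \<theta> p m n"
    using lie_deriv_tetrad_metric[where X = "e_sc S" and U = U and \<omega> = \<omega>
        and \<theta> = \<theta> and A = "weyl_form \<theta> At As Asc", OF U p X(2) d ann(2) tors w] weyl_form_e_s(2)[where \<theta> = \<theta> and p = p, OF ann] by simp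
qed

subsection \<open>The metric on real tangent vectors\<close>

text \<open>Since \<open>jet\<close> is a vector space, its elements also serve as real tangent
  vectors; their complexified components are obtained by applying \<open>coord_fun\<close>.\<close>

definition form_at :: "form1 \<Rightarrow> jet \<Rightarrow> jet \<Rightarrow> complex" where
  "form_at \<theta> p v = (\<Sum>m\<in>UNIV. \<theta> p m * coord_fun m v)"

definition tensor_at :: "tensor2 \<Rightarrow> jet \<Rightarrow> jet \<Rightarrow> jet \<Rightarrow> complex" where
  "tensor_at g p u v = (\<Sum>m\<in>UNIV. \<Sum>n\<in>UNIV. g p m n * coord_fun m u * coord_fun n v)"

lemma linear_form_at: "linear (form_at \<theta> p)"
proof -
  have "linear (coord_fun k)" for k
    using bounded_linear_coord_fun by (rule bounded_linear.linear)
  note lin = linear_add[OF this] linear_cmul[OF this]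
  show ?thesis
    by (rule linearI) (simp_all add: form_at_def lin sum.distrib scaleR_sum_right algebra_simps)
qed

lemma tensor_at_tetrad_metric:
  fixes \<theta> :: "tet \<Rightarrow> form1"
  shows "tensor_at (tetrad_metric \<theta>) p u v
    = (\<Sum>i\<in>UNIV. \<Sum>j\<in>UNIV. eta i j * form_at (\<theta> i) p u * form_at (\<theta> j) p v)"
proof -
  have "tensor_at (tetrad_metric \<theta>) p u v = (\<Sum>m\<in>UNIV. \<Sum>n\<in>UNIV. \<Sum>i\<in>UNIV. \<Sum>j\<in>UNIV.
      eta i j * (\<theta> i p m * coord_fun m u) * (\<theta> j p n * coord_fun n v))"
    by (simp add: tensor_at_def tetrad_metric_def sum_distrib_left sum_distrib_right mult_ac)
  also have "\<dots> = (\<Sum>m\<in>UNIV. \<Sum>i\<in>UNIV. \<Sum>j\<in>UNIV. \<Sum>n\<in>UNIV.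
      eta i j * (\<theta> i p m * coord_fun m u) * (\<theta> j p n * coord_fun n v))"
    by (simp only: sum.swap[of _ "UNIV :: tet set" "UNIV :: coord set"])
  also have "\<dots> = (\<Sum>i\<in>UNIV. \<Sum>j\<in>UNIV. \<Sum>m\<in>UNIV. \<Sum>n\<in>UNIV.
      eta i j * (\<theta> i p m * coord_fun m u) * (\<theta> j p n * coord_fun n v))"
    by (simp only: sum.swap[of _ "UNIV :: tet set" "UNIV :: coord set"])
  also have "\<dots> = (\<Sum>i\<in>UNIV. \<Sum>j\<in>UNIV. eta i j * form_at (\<theta> i) p u * form_at (\<theta> j) p v)"
    by (simp only: form_at_def sum_distrib_left[symmetric] sum_distrib_right[symmetric])
  finally show ?thesis .
qed

lemma tensor_at_tetrad_metric_commute: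
  "tensor_at (tetrad_metric \<theta>) p u v = tensor_at (tetrad_metric \<theta>) p v u"
  by (simp add: tensor_at_tetrad_metric sum_UNIV_tet eta_def)

text \<open>On real vectors conjugation fixes the values of the forms 0 and 1 and exchanges those of
  \<open>+\<close> and \<open>-\<close>. As \<open>eta\<close> is invariant under this exchange, the
  metric takes real values.\<close>

lemma tensor_at_theta_real:
  "of_real (Re (tensor_at (tetrad_metric (theta S \<Phi> \<alpha> b a c)) p u v))
    = tensor_at (tetrad_metric (theta S \<Phi> \<alpha> b a c)) p u v"
proof -
  have "cnj (form_at (theta S \<Phi> \<alpha> b a c T0) p v) = form_at (theta S \<Phi> \<alpha> b a c T0) p v"
    "cnj (form_at (theta S \<Phi> \<alpha> b a c T1) p v) = form_at (theta S \<Phi> \<alpha> b a c T1) p v"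
    "cnj (form_at (theta S \<Phi> \<alpha> b a c Tp) p v) = form_at (theta S \<Phi> \<alpha> b a c Tm) p v"
    "cnj (form_at (theta S \<Phi> \<alpha> b a c Tm) p v) = form_at (theta S \<Phi> \<alpha> b a c Tp) p v" for v
    by (simp_all add: form_at_def sum_UNIV_coord dcoord_def algebra_simps)
  then have "cnj (tensor_at (tetrad_metric (theta S \<Phi> \<alpha> b a c)) p u v)
    = tensor_at (tetrad_metric (theta S \<Phi> \<alpha> b a c)) p u v"
    by (simp add: tensor_at_tetrad_metric sum_UNIV_tet eta_def)
  then show ?thesis by (simp add: complex_eq_iff)
qed

text \<open>The system is triangular. Only the form 1 contains \<open>dR\<close>; then
  \<open>dW\<close> and \<open>dW\<^sup>*\<close> give a two by two system with determinant
  \<open>1 - b b\<^sup>*\<close> up to the factor \<open>\<Phi> \<alpha>\<close>; finally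
  \<open>dZ\<close> isolates the form 0.\<close>

lemma theta_linear_independent:
  assumes "tetrad_params U \<Phi> \<alpha> b a c" "p \<in> U"
    and "\<And>m. (\<Sum>i\<in>UNIV. l i * theta S \<Phi> \<alpha> b a c i p m) = 0"
  shows "l i = 0"
proof -
  have nz: "\<Phi> p \<noteq> 0" "\<alpha> p \<noteq> 0" "b p * cnj (b p) \<noteq> 1"
    using assms(1,2) by (auto simp: tetrad_params_def)
  have l1: "l T1 = 0"
    using assms(3)[of CR] nz by (simp add: sum_UNIV_tet dcoord_def)
  have "of_real (\<Phi> p * \<alpha> p) * (l Tp + l Tm * cnj (b p)) = 0"
    "of_real (\<Phi> p * \<alpha> p) * (l Tm + l Tp * b p) = 0"
    using assms(3)[of CW] assms(3)[of CWc] l1 by (simp_all add: sum_UNIV_tet dcoord_def algebra_simps)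
  then have "l Tp + l Tm * cnj (b p) = 0" "l Tm + l Tp * b p = 0" using nz by simp_all
  moreover have "l Tp * (1 - b p * cnj (b p)) = (l Tp + l Tm * cnj (b p)) - cnj (b p) * (l Tm + l Tp * b p)"
    by (simp add: algebra_simps)
  ultimately have l2: "l Tp = 0" "l Tm = 0" using nz by auto
  have "l T0 = 0"
    using assms(3)[of CZ] nz l1 l2 by (simp add: sum_UNIV_tet dcoord_def)
  with l1 l2 show ?thesis by (cases i) auto
qed

text \<open>The dual half of the coframe property. Once \<open>ds\<close> vanishes on
  \<open>v\<close>, the contact forms reduce to the differentials of the remaining coordinates, and
  the same determinant \<open>1 - b b\<^sup>*\<close> decides the \<open>W\<close> part.\<close>

lemma theta_js_jointly_injective:
  assumes "tetrad_params U \<Phi> \<alpha> b a c" "p \<in> U"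
    and "\<And>i. form_at (theta S \<Phi> \<alpha> b a c i) p v = 0" "js v = 0"
  shows "v = 0"
proof -
  have nz: "\<Phi> p \<noteq> 0" "\<alpha> p \<noteq> 0" "b p * cnj (b p) \<noteq> 1"
    using assms(1,2) by (auto simp: tetrad_params_def)
  have Z: "jZ v = 0"
    using assms(3)[of T0] assms(4) nz by (simp add: form_at_def sum_UNIV_coord dcoord_def)
  have "of_real (\<Phi> p * \<alpha> p) * (jW v + b p * cnj (jW v)) = 0"
    "of_real (\<Phi> p * \<alpha> p) * (cnj (jW v) + cnj (b p) * jW v) = 0"
    using assms(3)[of Tp] assms(3)[of Tm] assms(4)
    by (simp_all add: form_at_def sum_UNIV_coord dcoord_def algebra_simps)
  then have "jW v + b p * cnj (jW v) = 0" "cnj (jW v) + cnj (b p) * jW v = 0" using nz by simp_all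
  then have "jW v * (1 - b p * cnj (b p)) = 0" by algebra
  then have W: "jW v = 0" using nz by auto
  have "jR v = 0"
    using assms(3)[of T1] assms(4) nz Z W by (simp add: form_at_def sum_UNIV_coord dcoord_def)
  with Z W assms(4) show ?thesis
    by (cases v) (simp add: jZ_def jW_def jR_def js_def zero_prod_def)
qed

subsection \<open>Charts of the solution space\<close>

lemma real_imag_eq_wirt:
  "Re w *\<^sub>R A + Im w *\<^sub>R B = w * ((A - \<i> * B) / 2) + cnj w * ((A + \<i> * B) / 2)"
  by (simp add: complex_eq_iff field_simps)

locale solution_chart =
  fixes U :: "jet set" and S :: "jet \<Rightarrow> complex"
    and V :: "jet set" and x :: "jet \<Rightarrow> real ^ 4" and Y :: "((real ^ 4) \<times> complex) set"
    and \<phi> :: "(real ^ 4) \<times> complex \<Rightarrow> jet"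
  assumes pde: "integrable_pde_pair U S"
    and coords: "solution_coords U S V x Y \<phi>"
begin

lemma open_U: "open U" and open_V: "open V" and V_subset: "V \<subseteq> U" and open_Y: "open Y"
  and smooth_x: "smooth_on V x" and smooth_\<phi>: "smooth_on Y \<phi>"
  and chart_image: "(\<lambda>p. (x p, js p)) ` V = Y" and \<phi>_chart: "p \<in> V \<Longrightarrow> \<phi> (x p, js p) = p"
  and same_x: "p \<in> V \<Longrightarrow> q \<in> V \<Longrightarrow> x p = x q \<longleftrightarrow> (\<exists>N. integral_surface S V N \<and> p \<in> N \<and> q \<in> N)"
  using coords pde unfolding solution_coords_def integrable_pde_pair_def by blast+

lemma chart_in_Y: "p \<in> V \<Longrightarrow> (x p, js p) \<in> Y"
  using chart_image by blast

lemma \<phi>_in_V: "y \<in> Y \<Longrightarrow> \<phi> y \<in> V"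
  and chart_\<phi>: "y \<in> Y \<Longrightarrow> (x (\<phi> y), js (\<phi> y)) = y"
  using chart_image \<phi>_chart by force+

lemma x_\<phi>: "y \<in> Y \<Longrightarrow> x (\<phi> y) = fst y" and js_\<phi>: "y \<in> Y \<Longrightarrow> js (\<phi> y) = snd y"
  using chart_\<phi>[of y] by (auto simp: prod_eq_iff)

lemma \<phi>_in_U: "y \<in> Y \<Longrightarrow> \<phi> y \<in> U"
  using \<phi>_in_V V_subset by blast

lemma \<phi>_has_derivative: "y \<in> Y \<Longrightarrow> (\<phi> has_derivative frechet_derivative \<phi> (at y)) (at y)"
  by (rule smooth_on_has_derivative[OF smooth_\<phi>])

lemma linear_D\<phi>: "y \<in> Y \<Longrightarrow> linear (frechet_derivative \<phi> (at y))"
  using \<phi>_has_derivative has_derivative_linear by blast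

lemma smooth_on_compose_\<phi>: "smooth_on U f \<Longrightarrow> smooth_on Y (\<lambda>z. f (\<phi> z))"
  by (rule smooth_on_compose[OF open_Y open_U smooth_\<phi>]) (auto intro: \<phi>_in_U)

lemma smooth_on_coord_\<phi>: "smooth_on Y (\<lambda>z. coord_fun k (\<phi> z))"
  by (rule smooth_on_bounded_linear_compose[OF open_Y bounded_linear_coord_fun smooth_\<phi>])

text \<open>Equal labels put both points on one integral surface, and its parametrisation by
  \<open>s\<close> makes it the part of the slice at \<open>\<xi>\<close> lying over
  \<open>\<Sigma>\<close>. Connectedness of \<open>\<Sigma>\<close> comes from this surface; it is
  not assumed of the slices of \<open>Y\<close>.\<close>

lemma integral_surface_in_chart:
  assumes "(\<xi>, \<sigma>) \<in> Y" "(\<xi>, \<sigma>') \<in> Y"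
  obtains \<Sigma> \<Gamma> where "open \<Sigma>" "connected \<Sigma>" "\<sigma> \<in> \<Sigma>" "\<sigma>' \<in> \<Sigma>"
    "\<forall>\<tau>\<in>\<Sigma>. (\<xi>, \<tau>) \<in> Y \<and> \<phi> (\<xi>, \<tau>) = \<Gamma> \<tau>"
    "\<forall>\<tau>\<in>\<Sigma>. \<forall>k. wirt 1 \<i> (\<lambda>\<tau>. coord_fun k (\<Gamma> \<tau>)) \<tau> = e_s S (\<Gamma> \<tau>) k
      \<and> wirt_cnj 1 \<i> (\<lambda>\<tau>. coord_fun k (\<Gamma> \<tau>)) \<tau> = e_sc S (\<Gamma> \<tau>) k"
proof -
  let ?p = "\<phi> (\<xi>, \<sigma>)" and ?q = "\<phi> (\<xi>, \<sigma>')"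
  have pq: "?p \<in> V" "?q \<in> V" "x ?p = \<xi>" "x ?q = \<xi>" "js ?p = \<sigma>" "js ?q = \<sigma>'"
    using assms \<phi>_in_V chart_\<phi> by (auto dest: chart_\<phi>)
  then obtain N where N: "integral_surface S V N" "?p \<in> N" "?q \<in> N"
    using same_x[of ?p ?q] by auto
  then obtain \<Sigma> \<Gamma> where \<Sigma>: "open \<Sigma>" "connected \<Sigma>" "smooth_on \<Sigma> \<Gamma>" "N = \<Gamma> ` \<Sigma>" "N \<subseteq> V"
    and \<Gamma>: "\<forall>\<sigma>\<in>\<Sigma>. js (\<Gamma> \<sigma>) = \<sigma> \<and>
          (\<forall>k. wirt 1 \<i> (\<lambda>\<tau>. coord_fun k (\<Gamma> \<tau>)) \<sigma> = e_s S (\<Gamma> \<sigma>) k \<and>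
               wirt_cnj 1 \<i> (\<lambda>\<tau>. coord_fun k (\<Gamma> \<tau>)) \<sigma> = e_sc S (\<Gamma> \<sigma>) k)"
    unfolding integral_surface_def by (elim conjE exE)
  note js_\<Gamma> = bspec[OF \<Gamma>, THEN conjunct1]
    and wirt_\<Gamma> = bspec[OF \<Gamma>, THEN conjunct2]
  have eq: "\<forall>\<tau>\<in>\<Sigma>. (\<xi>, \<tau>) \<in> Y \<and> \<phi> (\<xi>, \<tau>) = \<Gamma> \<tau>"
  proof
    fix \<tau> assume \<tau>: "\<tau> \<in> \<Sigma>"
    have "\<Gamma> \<tau> \<in> V" "\<Gamma> \<tau> \<in> N" using \<Sigma> \<tau> by auto
    \<comment> \<open>Every point of \<open>N\<close> shares its label with
      \<open>\<phi> (\<xi>, \<sigma>)\<close>, since both lie on the same integral surface.\<close>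
    then have "x (\<Gamma> \<tau>) = \<xi>" using same_x[of "\<Gamma> \<tau>" ?p] N pq by auto
    moreover have "js (\<Gamma> \<tau>) = \<tau>" by (rule js_\<Gamma>[OF \<tau>])
    ultimately show "(\<xi>, \<tau>) \<in> Y \<and> \<phi> (\<xi>, \<tau>) = \<Gamma> \<tau>"
      using chart_in_Y[OF \<open>\<Gamma> \<tau> \<in> V\<close>] \<phi>_chart[OF \<open>\<Gamma> \<tau> \<in> V\<close>] by simp
  qed
  have "\<sigma> \<in> \<Sigma>" "\<sigma>' \<in> \<Sigma>"
    using N(2,3) js_\<Gamma> pq(5,6) unfolding \<Sigma>(4) by force+
  then show ?thesis by (rule that[OF \<Sigma>(1,2) _ _ eq ballI[OF wirt_\<Gamma>]])
qed

text \<open>Near its foot point the slice coincides with a parametrised integral surface, whose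
  Wirtinger derivatives are the two vector fields by definition.\<close>

lemma chart_coord_\<phi>:
  assumes y: "y \<in> Y"
  shows "chart_ds (\<lambda>z. coord_fun k (\<phi> z)) y = e_s S (\<phi> y) k"
    and "chart_dsc (\<lambda>z. coord_fun k (\<phi> z)) y = e_sc S (\<phi> y) k"
proof -
  obtain \<xi> \<sigma> where y_eq: "y = (\<xi>, \<sigma>)" by (cases y)
  \<comment> \<open>Only a neighbourhood of a single point of the slice matters, so the same point
    is used twice.\<close>
  obtain \<Sigma> \<Gamma> where \<Sigma>: "open \<Sigma>" "connected \<Sigma>" "\<sigma> \<in> \<Sigma>" "\<sigma> \<in> \<Sigma>"
    and eq: "\<forall>\<tau>\<in>\<Sigma>. (\<xi>, \<tau>) \<in> Y \<and> \<phi> (\<xi>, \<tau>) = \<Gamma> \<tau>"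
    and \<Gamma>: "\<forall>\<tau>\<in>\<Sigma>. \<forall>k. wirt 1 \<i> (\<lambda>\<tau>. coord_fun k (\<Gamma> \<tau>)) \<tau> = e_s S (\<Gamma> \<tau>) k
      \<and> wirt_cnj 1 \<i> (\<lambda>\<tau>. coord_fun k (\<Gamma> \<tau>)) \<tau> = e_sc S (\<Gamma> \<tau>) k"
    by (rule integral_surface_in_chart[OF y[unfolded y_eq] y[unfolded y_eq]]) (rule that; assumption)
  let ?F = "\<lambda>z. coord_fun k (\<phi> z)"
  have "frechet_derivative ?F (at y) (0, w) = frechet_derivative (\<lambda>\<tau>. coord_fun k (\<Gamma> \<tau>)) (at \<sigma>) w" for w
  proof -
    have "((\<lambda>\<tau>. (\<xi>, \<tau>)) has_derivative (\<lambda>w. (0, w))) (at \<sigma>)"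
      by (auto intro!: derivative_eq_intros)
    moreover have "(?F has_derivative frechet_derivative ?F (at y)) (at (\<xi>, \<sigma>))"
      using smooth_on_has_derivative[OF smooth_on_coord_\<phi> y] y_eq by simp
    ultimately have "((\<lambda>\<tau>. ?F (\<xi>, \<tau>)) has_derivative (\<lambda>w. frechet_derivative ?F (at y) (0, w))) (at \<sigma>)"
      by (rule has_derivative_compose)
    then have "((\<lambda>\<tau>. coord_fun k (\<Gamma> \<tau>)) has_derivative (\<lambda>w. frechet_derivative ?F (at y) (0, w))) (at \<sigma>)"
      by (rule has_derivative_transform_within_open[OF _ \<Sigma>(1,3)]) (use eq in auto)
    from fun_cong[OF frechet_derivative_at[OF this], of w] show ?thesis by simp
  qed
  with bspec[OF \<Gamma> \<Sigma>(3), THEN spec, of k] bspec[OF eq \<Sigma>(3)]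
  show "chart_ds ?F y = e_s S (\<phi> y) k" "chart_dsc ?F y = e_sc S (\<phi> y) k"
    by (simp_all add: chart_ds_def chart_dsc_def wirt_def wirt_cnj_def y_eq)
qed

text \<open>The real vector \<open>D\<phi>(0, w)\<close> is tangent to the integral surface: its
  complexified components are those of
  \<open>w e\<^sub>s + w\<^sup>* e\<^sub>s\<^sub>*\<close>.\<close>

lemma form_at_D\<phi>_vertical:
  assumes y: "y \<in> Y"
    and ann: "\<And>p. (\<Sum>k\<in>UNIV. \<theta> p k * e_s S p k) = 0" "\<And>p. (\<Sum>k\<in>UNIV. \<theta> p k * e_sc S p k) = 0"
  shows "form_at \<theta> (\<phi> y) (frechet_derivative \<phi> (at y) (0, w)) = 0"
proof -
  have "coord_fun k (frechet_derivative \<phi> (at y) (0, w)) = w * e_s S (\<phi> y) k + cnj w * e_sc S (\<phi> y) k" for k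
  proof -
    let ?L = "frechet_derivative (\<lambda>z. coord_fun k (\<phi> z)) (at y)"
    have lin: "linear ?L"
      using smooth_on_has_derivative[OF smooth_on_coord_\<phi> y] has_derivative_linear by blast
    have w: "(0, w) = Re w *\<^sub>R (0, 1) + Im w *\<^sub>R (0, \<i>)" by (simp add: complex_eq_iff)
    have "?L (0, w) = Re w *\<^sub>R ?L (0, 1) + Im w *\<^sub>R ?L (0, \<i>)"
      by (subst w) (simp only: linear_add[OF lin] linear_cmul[OF lin])
    also have "\<dots> = w * chart_ds (\<lambda>z. coord_fun k (\<phi> z)) y + cnj w * chart_dsc (\<lambda>z. coord_fun k (\<phi> z)) y"
      unfolding chart_ds_def chart_dsc_def wirt_def wirt_cnj_def by (rule real_imag_eq_wirt)
    finally show ?thesis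
      by (simp only: chart_coord_\<phi>[OF y]
          frechet_derivative_coord_fun_compose[OF smooth_on_imp_differentiable[OF smooth_\<phi> y]])
  qed
  then have "form_at \<theta> (\<phi> y) (frechet_derivative \<phi> (at y) (0, w))
    = w * (\<Sum>k\<in>UNIV. \<theta> (\<phi> y) k * e_s S (\<phi> y) k) + cnj w * (\<Sum>k\<in>UNIV. \<theta> (\<phi> y) k * e_sc S (\<phi> y) k)"
    by (simp add: form_at_def sum_distrib_left sum.distrib algebra_simps)
  then show ?thesis by (simp add: ann)
qed

definition frame :: "4 \<Rightarrow> (real ^ 4) \<times> complex \<Rightarrow> jet" where
  "frame k y = frechet_derivative \<phi> (at y) (axis k 1, 0)"

lemma D\<phi>_horizontal:
  assumes "y \<in> Y"
  shows "frechet_derivative \<phi> (at y) (w, 0) = (\<Sum>k\<in>UNIV. (w $ k) *\<^sub>R frame k y)"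
proof -
  have "(w, 0 :: complex) = (\<Sum>k\<in>UNIV. (w $ k) *\<^sub>R (axis k 1, 0))"
    by (simp add: prod_eq_iff fst_sum snd_sum vec_eq_iff axis_def if_distrib cong: if_cong)
  then show ?thesis
    by (simp add: frame_def linear_sum[OF linear_D\<phi>[OF assms]] linear_cmul[OF linear_D\<phi>[OF assms]]
        del: scaleR_Pair)
qed

section \<open>The mutually inverse differentials of the chart and of its inverse\<close>

lemma x_has_derivative: "p \<in> V \<Longrightarrow> (x has_derivative frechet_derivative x (at p)) (at p)"
  by (rule smooth_on_has_derivative[OF smooth_x])

lemma D\<phi>_chart:
  assumes p: "p \<in> V"
  shows "frechet_derivative \<phi> (at (x p, js p)) (frechet_derivative x (at p) v, js v) = v"
proof -
  have "((\<lambda>p. (x p, js p)) has_derivative (\<lambda>v. (frechet_derivative x (at p) v, js v))) (at p)"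
    by (intro has_derivative_Pair x_has_derivative p bounded_linear_imp_has_derivative bounded_linear_jet)
  from has_derivative_compose[OF this \<phi>_has_derivative[OF chart_in_Y[OF p]]]
  have "((\<lambda>p. p) has_derivative (\<lambda>v. frechet_derivative \<phi> (at (x p, js p)) (frechet_derivative x (at p) v, js v))) (at p)"
    by (rule has_derivative_transform_within_open[OF _ open_V p]) (simp add: \<phi>_chart)
  from fun_cong[OF has_derivative_unique[OF this has_derivative_ident], of v] show ?thesis by simp
qed

lemma chart_D\<phi>:
  assumes y: "y \<in> Y"
  shows "frechet_derivative x (at (\<phi> y)) (frechet_derivative \<phi> (at y) w) = fst w"
    and "js (frechet_derivative \<phi> (at y) w) = snd w"
proof -
  have "((\<lambda>y. x (\<phi> y)) has_derivative (\<lambda>w. frechet_derivative x (at (\<phi> y)) (frechet_derivative \<phi> (at y) w))) (at y)"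
    by (rule has_derivative_compose[OF \<phi>_has_derivative[OF y] x_has_derivative[OF \<phi>_in_V[OF y]]])
  then have "(fst has_derivative (\<lambda>w. frechet_derivative x (at (\<phi> y)) (frechet_derivative \<phi> (at y) w))) (at y)"
    by (rule has_derivative_transform_within_open[OF _ open_Y y]) (rule x_\<phi>)
  from fun_cong[OF has_derivative_unique[OF this bounded_linear_imp_has_derivative[OF bounded_linear_fst]], of w]
  show "frechet_derivative x (at (\<phi> y)) (frechet_derivative \<phi> (at y) w) = fst w" by simp
  have "((\<lambda>y. js (\<phi> y)) has_derivative (\<lambda>w. js (frechet_derivative \<phi> (at y) w))) (at y)"
    by (rule bounded_linear.has_derivative[OF bounded_linear_jet(4) \<phi>_has_derivative[OF y]])
  then have "(snd has_derivative (\<lambda>w. js (frechet_derivative \<phi> (at y) w))) (at y)"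
    by (rule has_derivative_transform_within_open[OF _ open_Y y]) (rule js_\<phi>)
  from fun_cong[OF has_derivative_unique[OF this bounded_linear_imp_has_derivative[OF bounded_linear_snd]], of w]
  show "js (frechet_derivative \<phi> (at y) w) = snd w" by simp
qed

text \<open>A form that kills both vector fields sees only the horizontal part of a vector, so it is
  a combination of the \<open>dx\<^sup>k\<close>. The coefficients still depend on
  \<open>s\<close>.\<close>

lemma form_eq_sum_dx:
  assumes p: "p \<in> V"
    and ann: "\<And>p. (\<Sum>k\<in>UNIV. \<theta> p k * e_s S p k) = 0" "\<And>p. (\<Sum>k\<in>UNIV. \<theta> p k * e_sc S p k) = 0"
  shows "\<theta> p m = (\<Sum>k\<in>UNIV. form_at \<theta> p (frame k (x p, js p)) * dfun (\<lambda>q. of_real (x q $ k)) p m)"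
proof -
  let ?y = "(x p, js p)"
  note y = chart_in_Y[OF p]
  have "form_at \<theta> p v = (\<Sum>k\<in>UNIV. form_at \<theta> p (frame k ?y) * (\<Sum>m\<in>UNIV. dfun (\<lambda>q. of_real (x q $ k)) p m * coord_fun m v))" for v
  proof -
    let ?w = "frechet_derivative x (at p) v"
    \<comment> \<open>The chart splits \<open>v\<close> into a part along the \<open>x\<close>
      directions and a part along the integral surface; the form annihilates the second.\<close>
    have "form_at \<theta> p v = form_at \<theta> p (frechet_derivative \<phi> (at ?y) ((?w, 0) + (0, js v)))"
      using D\<phi>_chart[OF p, of v] by simp
    also have "\<dots> = form_at \<theta> p (frechet_derivative \<phi> (at ?y) (?w, 0))
        + form_at \<theta> p (frechet_derivative \<phi> (at ?y) (0, js v))"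
      by (simp only: linear_add[OF linear_D\<phi>[OF y]] linear_add[OF linear_form_at])
    also have "form_at \<theta> p (frechet_derivative \<phi> (at ?y) (0, js v)) = 0"
      using form_at_D\<phi>_vertical[OF y ann, of "js v"] by (simp only: \<phi>_chart[OF p])
    finally have "form_at \<theta> p v = form_at \<theta> p (frechet_derivative \<phi> (at ?y) (?w, 0))"
      by simp
    also have "\<dots> = (\<Sum>k\<in>UNIV. (?w $ k) *\<^sub>R form_at \<theta> p (frame k ?y))"
      by (simp add: D\<phi>_horizontal[OF y] linear_sum[OF linear_form_at] linear_cmul[OF linear_form_at])
    finally have *: "form_at \<theta> p v = (\<Sum>k\<in>UNIV. (?w $ k) *\<^sub>R form_at \<theta> p (frame k ?y))" .
    have "of_real (?w $ k) = (\<Sum>m\<in>UNIV. dfun (\<lambda>q. of_real (x q $ k)) p m * coord_fun m v)" for k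
    proof -
      have bl: "bounded_linear (\<lambda>w :: real ^ 4. complex_of_real (w $ k))"
        by (intro bounded_linear_compose[OF bounded_linear_of_real] bounded_linear_vec_nth)
      note dx = smooth_on_imp_differentiable[OF smooth_x p]
      have "(\<lambda>q. complex_of_real (x q $ k)) differentiable at p"
        using smooth_on_imp_differentiable[OF smooth_on_bounded_linear_compose[OF open_V bl smooth_x] p] .
      from frechet_derivative_eq_pd[OF this, of v] frechet_derivative_bounded_linear_compose[OF bl dx, of v]
      show ?thesis by (simp add: dfun_def mult.commute)
    qed
    then have "(\<Sum>k\<in>UNIV. (?w $ k) *\<^sub>R form_at \<theta> p (frame k ?y))
      = (\<Sum>k\<in>UNIV. form_at \<theta> p (frame k ?y) * (\<Sum>m\<in>UNIV. dfun (\<lambda>q. of_real (x q $ k)) p m * coord_fun m v))"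
      by (simp add: scaleR_conv_of_real mult.commute)
    with * show ?thesis by (simp only:)
  qed
  note expand = this
  \<comment> \<open>So far the two forms agree on real vectors; this is enough to compare their
    complexified components.\<close>
  have "(\<Sum>m\<in>UNIV. (\<theta> p m - (\<Sum>k\<in>UNIV. form_at \<theta> p (frame k ?y) * dfun (\<lambda>q. of_real (x q $ k)) p m)) * coord_fun m v) = 0" for v
  proof -
    have "(\<Sum>m\<in>UNIV. \<Sum>k\<in>UNIV. form_at \<theta> p (frame k ?y) * (dfun (\<lambda>q. of_real (x q $ k)) p m * coord_fun m v))
      = (\<Sum>k\<in>UNIV. \<Sum>m\<in>UNIV. form_at \<theta> p (frame k ?y) * (dfun (\<lambda>q. of_real (x q $ k)) p m * coord_fun m v))"
      by (rule sum.swap)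
    also have "\<dots> = form_at \<theta> p v"
      by (simp only: expand[of v] sum_distrib_left)
    finally show ?thesis
      by (simp only: form_at_def[of \<theta> p v] left_diff_distrib sum_subtractf sum_distrib_right mult.assoc) simp
  qed
  from coord_fun_functional_eq_0[OF this, of m] show ?thesis by simp
qed

end

subsection \<open>The conformal metric on the solution space\<close>

locale weyl_chart = solution_chart +
  fixes \<Phi> \<alpha> c :: "jet \<Rightarrow> real" and b a :: "jet \<Rightarrow> complex"
    and \<theta> :: "tet \<Rightarrow> form1" and \<omega> :: "tet \<Rightarrow> tet \<Rightarrow> form1"
    and At :: "tet \<Rightarrow> jet \<Rightarrow> complex" and As Asc :: "jet \<Rightarrow> complex"
  assumes params: "tetrad_params U \<Phi> \<alpha> b a c"
    and \<theta>_eq: "\<theta> = theta S \<Phi> \<alpha> b a c"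
    and weyl: "torsion_free_gen_weyl U \<theta> \<omega> (weyl_form \<theta> At As Asc)"
begin

abbreviation "g \<equiv> tetrad_metric \<theta>"

text \<open>The matrix of \<open>g\<close> in the frame of the coordinates \<open>x\<close>. The
  real part only changes the type, since these values are already real.\<close>

definition metric :: "(real ^ 4) \<times> complex \<Rightarrow> real ^ 4 ^ 4" where
  "metric y = (\<chi> k l. Re (tensor_at g (\<phi> y) (frame k y) (frame l y)))"

lemma metric_eq: "of_real (metric y $ k $ l) = tensor_at g (\<phi> y) (frame k y) (frame l y)"
  unfolding metric_def by (simp only: vec_lambda_beta \<theta>_eq tensor_at_theta_real)

lemma \<theta>_annihilates: "(\<Sum>k\<in>UNIV. \<theta> i p k * e_s S p k) = 0" "(\<Sum>k\<in>UNIV. \<theta> i p k * e_sc S p k) = 0"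
  unfolding \<theta>_eq by (rule theta_e_s)+

lemma smooth_g: "smooth_on U (\<lambda>p. g p m n)"
  by (rule smooth_on_tetrad_metric[OF open_U]) (unfold \<theta>_eq, rule smooth_on_theta[OF pde params])

text \<open>Writes the frame components as first derivatives of scalar functions, so that
  differentiating them once more falls under the symmetry of second derivatives.\<close>

lemma coord_fun_frame:
  "y \<in> Y \<Longrightarrow> coord_fun m (frame k y) = frechet_derivative (\<lambda>z. coord_fun m (\<phi> z)) (at y) (axis k 1, 0)"
  by (simp add: frame_def
      frechet_derivative_coord_fun_compose[OF smooth_on_imp_differentiable[OF smooth_\<phi>]])

lemma smooth_coord_fun_frame: "smooth_on Y (\<lambda>y. coord_fun m (frame k y))"
proof -
  have "smooth_on Y (\<lambda>y. frechet_derivative (\<lambda>z. coord_fun m (\<phi> z)) (at y) (axis k 1, 0))"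
    by (rule smooth_on_frechet_derivative[OF smooth_on_coord_\<phi>])
  then show ?thesis
    by (rule smooth_on_cong[OF open_Y, THEN iffD1, rotated]) (simp add: coord_fun_frame)
qed

lemma smooth_metric: "smooth_on Y metric"
  unfolding metric_def[abs_def]
proof (intro smooth_on_vec_lambda open_Y)
  fix k l
  have "smooth_on Y (\<lambda>y. tensor_at g (\<phi> y) (frame k y) (frame l y))"
    unfolding tensor_at_def
    by (intro smooth_on_sum smooth_on_mult smooth_coord_fun_frame smooth_on_compose_\<phi> smooth_g open_Y)
  then show "smooth_on Y (\<lambda>y. Re (tensor_at g (\<phi> y) (frame k y) (frame l y)))"
    by (rule smooth_on_bounded_linear_compose[OF open_Y bounded_linear_Re])
qed

lemma g_eq_metric:
  assumes p: "p \<in> V"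
  shows "g p m n = (\<Sum>k\<in>UNIV. \<Sum>l\<in>UNIV. of_real (metric (x p, js p) $ k $ l)
    * dfun (\<lambda>q. of_real (x q $ k)) p m * dfun (\<lambda>q. of_real (x q $ l)) p n)"
proof -
  let ?d = "\<lambda>k m. dfun (\<lambda>q. complex_of_real (x q $ k)) p m"
  let ?F = "\<lambda>i k. form_at (\<theta> i) p (frame k (x p, js p))"
  have \<theta>: "\<theta> i p m = (\<Sum>k\<in>UNIV. ?F i k * ?d k m)" for i m
    by (rule form_eq_sum_dx[OF p \<theta>_annihilates])
  have "g p m n = (\<Sum>i\<in>UNIV. \<Sum>j\<in>UNIV. eta i j * (\<Sum>k\<in>UNIV. ?F i k * ?d k m) * (\<Sum>l\<in>UNIV. ?F j l * ?d l n))"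
    unfolding tetrad_metric_def by (simp only: \<theta>)
  also have "\<dots> = (\<Sum>i\<in>UNIV. \<Sum>j\<in>UNIV. \<Sum>k\<in>UNIV. \<Sum>l\<in>UNIV. eta i j * ?F i k * ?F j l * ?d k m * ?d l n)"
    by (simp add: sum_distrib_left sum_distrib_right mult_ac)
  also have "\<dots> = (\<Sum>i\<in>UNIV. \<Sum>k\<in>UNIV. \<Sum>l\<in>UNIV. \<Sum>j\<in>UNIV. eta i j * ?F i k * ?F j l * ?d k m * ?d l n)"
    by (simp only: sum.swap[of _ "UNIV :: 4 set" "UNIV :: tet set"])
  also have "\<dots> = (\<Sum>k\<in>UNIV. \<Sum>l\<in>UNIV. \<Sum>i\<in>UNIV. \<Sum>j\<in>UNIV. eta i j * ?F i k * ?F j l * ?d k m * ?d l n)"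
    by (simp only: sum.swap[of _ "UNIV :: 4 set" "UNIV :: tet set"])
  also have "\<dots> = (\<Sum>k\<in>UNIV. \<Sum>l\<in>UNIV. of_real (metric (x p, js p) $ k $ l) * ?d k m * ?d l n)"
    by (simp only: metric_eq tensor_at_tetrad_metric \<phi>_chart[OF p] sum_distrib_right)
  finally show ?thesis .
qed

lemma transpose_metric: "transpose (metric y) = metric y"
  by (simp add: metric_def transpose_def vec_eq_iff tensor_at_tetrad_metric_commute)

text \<open>A kernel vector \<open>w\<close> lifts to a vector \<open>?u\<close> with
  \<open>g(?u, _) = 0\<close>. Independence of the tetrad forms and invertibility of
  \<open>eta\<close> force all tetrad forms to vanish on \<open>?u\<close>; \<open>ds\<close>
  vanishes as well because \<open>?u\<close> is horizontal. Hence \<open>?u = 0\<close> and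
  \<open>w = 0\<close>.\<close>

lemma det_metric:
  assumes y: "y \<in> Y"
  shows "det (metric y) \<noteq> 0"
proof -
  let ?p = "\<phi> y"
  have p: "?p \<in> V" "?p \<in> U" "(x ?p, js ?p) = y"
    using y \<phi>_in_V \<phi>_in_U chart_\<phi> by auto
  have "w = 0" if w: "metric y *v w = 0" for w
  proof -
    let ?u = "frechet_derivative \<phi> (at y) (w, 0)"
    let ?d = "\<lambda>k m. dfun (\<lambda>q. complex_of_real (x q $ k)) ?p m"
    let ?F = "\<lambda>i k. form_at (\<theta> i) ?p (frame k y)"
    have u: "form_at (\<theta> i) ?p ?u = (\<Sum>l\<in>UNIV. of_real (w $ l) * ?F i l)" for i
      by (simp add: D\<phi>_horizontal[OF y] linear_sum[OF linear_form_at] linear_cmul[OF linear_form_at]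
          scaleR_conv_of_real)
    have ker: "(\<Sum>i\<in>UNIV. \<Sum>j\<in>UNIV. eta i j * ?F i k * form_at (\<theta> j) ?p ?u) = 0" for k
    proof -
      have "0 = of_real ((metric y *v w) $ k)" using w by simp
      also have "\<dots> = (\<Sum>l\<in>UNIV. tensor_at g ?p (frame k y) (frame l y) * of_real (w $ l))"
        by (simp add: matrix_vector_mult_def metric_eq)
      also have "\<dots> = (\<Sum>l\<in>UNIV. \<Sum>i\<in>UNIV. \<Sum>j\<in>UNIV. eta i j * ?F i k * (of_real (w $ l) * ?F j l))"
        by (simp add: tensor_at_tetrad_metric sum_distrib_left sum_distrib_right mult_ac)
      also have "\<dots> = (\<Sum>i\<in>UNIV. \<Sum>j\<in>UNIV. \<Sum>l\<in>UNIV. eta i j * ?F i k * (of_real (w $ l) * ?F j l))"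
        by (simp only: sum.swap[of _ "UNIV :: tet set" "UNIV :: 4 set"])
      also have "\<dots> = (\<Sum>i\<in>UNIV. \<Sum>j\<in>UNIV. eta i j * ?F i k * form_at (\<theta> j) ?p ?u)"
        by (simp only: u sum_distrib_left)
      finally show ?thesis by simp
    qed
    \<comment> \<open>\<open>L i\<close> are the coefficients of the covector
      \<open>g(?u, _)\<close> in the tetrad. Expanding the tetrad in the \<open>dx\<^sup>k\<close>
      turns them into the sums that vanish by \<open>ker\<close>.\<close>
    define L where "L i = (\<Sum>j\<in>UNIV. eta i j * form_at (\<theta> j) ?p ?u)" for i
    have "(\<Sum>i\<in>UNIV. L i * \<theta> i ?p m) = 0" for m
    proof -
      have "(\<Sum>i\<in>UNIV. L i * \<theta> i ?p m) = (\<Sum>i\<in>UNIV. \<Sum>k\<in>UNIV. ?d k m * (?F i k * L i))"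
        by (subst form_eq_sum_dx[OF p(1) \<theta>_annihilates]) (simp add: p(3) sum_distrib_left mult_ac)
      also have "\<dots> = (\<Sum>k\<in>UNIV. ?d k m * (\<Sum>i\<in>UNIV. ?F i k * L i))"
        by (subst sum.swap) (simp add: sum_distrib_left)
      also have "\<dots> = 0"
        using ker by (simp add: L_def sum_distrib_left mult_ac)
      finally show ?thesis .
    qed
    then have L: "L i = 0" for i
      using theta_linear_independent[OF params p(2), of L] unfolding \<theta>_eq by blast
    \<comment> \<open>Each row of \<open>eta\<close> has a single nonzero entry, so every
      \<open>L\<close> is one of these values up to sign.\<close>
    have "form_at (\<theta> i) ?p ?u = 0" for i
      using L[of T0] L[of T1] L[of Tp] L[of Tm]
      by (cases i) (simp_all add: L_def sum_UNIV_tet eta_def)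
    moreover have "js ?u = 0" by (simp add: chart_D\<phi>[OF y])
    ultimately have "?u = 0"
      using theta_js_jointly_injective[OF params p(2)] unfolding \<theta>_eq by blast
    moreover have "w = frechet_derivative x (at ?p) ?u" by (simp add: chart_D\<phi>[OF y])
    ultimately show "w = 0"
      using linear_0[OF has_derivative_linear[OF x_has_derivative[OF p(1)]]] by simp
  qed
  then have "\<exists>B. B ** metric y = mat 1" by (simp add: matrix_left_invertible_ker)
  then show ?thesis
    by (simp add: invertible_det_nz[symmetric] invertible_left_inverse)
qed

text \<open>The disjunction in \<open>D\<close> treats the derivatives in \<open>s\<close> and in
  \<open>s\<^sup>*\<close> by one argument: only linearity, the product rule, commutation with
  \<open>\<partial>\<^sub>k\<close> and the identification of the slice derivative with
  \<open>X\<close> are used.\<close>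

lemma chart_derivative_metric:
  assumes D: "D = chart_ds \<and> X = e_s S \<and> A = As \<or> D = chart_dsc \<and> X = e_sc S \<and> A = Asc"
    and y: "y \<in> Y"
  shows "D (\<lambda>z. of_real (metric z $ k $ l)) y = - 2 * A (\<phi> y) * of_real (metric y $ k $ l)"
proof -
  have D_mult: "D (\<lambda>z. f z * h z) y = D f y * h y + f y * D h y"
    if "f differentiable at y" "h differentiable at y" for f h
    using D by (elim disjE) (simp_all add: chart_ds_def chart_dsc_def wirt_mult[OF that])
  have D_sum: "D (\<lambda>z. \<Sum>m\<in>UNIV. f m z) y = (\<Sum>m\<in>UNIV. D (f m) y)"
    if "\<And>m. f m differentiable at y" for f :: "coord \<Rightarrow> _"
    using D by (elim disjE) (simp_all add: chart_ds_def chart_dsc_def wirt_sum that)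
  have D_cong: "D f y = D h y" if "f differentiable at y" "\<And>z. z \<in> Y \<Longrightarrow> f z = h z" for f h
    using D by (elim disjE) (simp_all add: chart_ds_def chart_dsc_def wirt_cong_open[OF open_Y y that])
  have D_coord: "D (\<lambda>z. coord_fun m (\<phi> z)) z = X (\<phi> z) m" if "z \<in> Y" for m z
    using D by (elim disjE) (simp_all add: chart_coord_\<phi>[OF that])
  have diff\<phi>: "\<phi> differentiable at y" by (rule smooth_on_imp_differentiable[OF smooth_\<phi> y])
  have diffg: "(\<lambda>q. g q m n) differentiable at (\<phi> y)" for m n
    by (rule smooth_on_imp_differentiable[OF smooth_g \<phi>_in_U[OF y]])
  have smoothX: "smooth_on U (\<lambda>q. X q m)" for m
    using D by (elim disjE) (simp_all add: smooth_on_e_s[OF pde])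
  have lie: "lie_deriv X g (\<phi> y) m n = - 2 * A (\<phi> y) * g (\<phi> y) m n" for m n
    using D by (elim disjE) (simp_all add: lie_deriv_tetrad_metric_e_s[OF pde params \<theta>_eq weyl \<phi>_in_U[OF y]])
  have D_g: "D (\<lambda>z. g (\<phi> z) m n) y = (\<Sum>j\<in>UNIV. X (\<phi> y) j * pd j (\<lambda>q. g q m n) (\<phi> y))" for m n
    using D D_coord[OF y]
    by (elim disjE) (simp_all add: chart_ds_def chart_dsc_def wirt_chain_pd[OF diff\<phi> diffg])
  \<comment> \<open>The slice derivative of \<open>\<partial>\<^sub>k \<phi>\<^sup>m\<close> is
    \<open>\<partial>\<^sub>k\<close> of the slice derivative of \<open>\<phi>\<^sup>m\<close>, and
    the latter is the component \<open>X\<^sup>m\<close> along \<open>\<phi>\<close>. Thus the frame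
    vector varies by the derivative of \<open>X\<close> along itself, which supplies the terms of
    the Lie derivative that differentiate \<open>X\<close>.\<close>
  have D_frame: "D (\<lambda>z. coord_fun m (frame k z)) y
    = (\<Sum>j\<in>UNIV. coord_fun j (frame k y) * pd j (\<lambda>q. X q m) (\<phi> y))" for m k
  proof -
    let ?f = "\<lambda>z. coord_fun m (\<phi> z)"
    have "D (\<lambda>z. coord_fun m (frame k z)) y = D (\<lambda>z. frechet_derivative ?f (at z) (axis k 1, 0)) y"
      by (rule D_cong) (simp_all add: smooth_on_imp_differentiable[OF smooth_coord_fun_frame y] coord_fun_frame)
    also have "\<dots> = frechet_derivative (D ?f) (at y) (axis k 1, 0)"
      using D by (elim disjE) (simp_all add: chart_ds_def[abs_def] chart_dsc_def[abs_def]
          wirt_frechet_derivative_commute[OF open_Y smooth_on_coord_\<phi> y])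
    also have "\<dots> = frechet_derivative (\<lambda>z. X (\<phi> z) m) (at y) (axis k 1, 0)"
    proof -
      have "frechet_derivative (\<lambda>z. X (\<phi> z) m) (at y) = frechet_derivative (D ?f) (at y)"
        by (rule frechet_derivative_transform_within_open[OF _ open_Y y])
          (simp_all add: smooth_on_imp_differentiable[OF smooth_on_compose_\<phi>[OF smoothX] y] D_coord)
      then show ?thesis by simp
    qed
    also have "\<dots> = (\<Sum>j\<in>UNIV. coord_fun j (frame k y) * pd j (\<lambda>q. X q m) (\<phi> y))"
      using frechet_derivative_chain_pd[OF diff\<phi> smooth_on_imp_differentiable[OF smoothX \<phi>_in_U[OF y]]]
      by (simp add: coord_fun_frame[OF y])
    finally show ?thesis .
  qed
  have d: "(\<lambda>z. g (\<phi> z) m n) differentiable at y" "(\<lambda>z. coord_fun m (frame k z)) differentiable at y" for m n k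
    using smooth_on_imp_differentiable[OF smooth_on_compose_\<phi>[OF smooth_g] y]
      smooth_on_imp_differentiable[OF smooth_coord_fun_frame y] by blast+
  have "D (\<lambda>z. of_real (metric z $ k $ l)) y
    = D (\<lambda>z. \<Sum>m\<in>UNIV. \<Sum>n\<in>UNIV. g (\<phi> z) m n * coord_fun m (frame k z) * coord_fun n (frame l z)) y"
    by (simp only: metric_eq tensor_at_def)
  also have "\<dots> = (\<Sum>m\<in>UNIV. \<Sum>n\<in>UNIV. D (\<lambda>z. g (\<phi> z) m n * coord_fun m (frame k z) * coord_fun n (frame l z)) y)"
  proof -
    have "D (\<lambda>z. \<Sum>n\<in>UNIV. g (\<phi> z) m n * coord_fun m (frame k z) * coord_fun n (frame l z)) y
      = (\<Sum>n\<in>UNIV. D (\<lambda>z. g (\<phi> z) m n * coord_fun m (frame k z) * coord_fun n (frame l z)) y)" for m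
      by (rule D_sum) (intro differentiable_mult d)
    moreover have "D (\<lambda>z. \<Sum>m\<in>UNIV. \<Sum>n\<in>UNIV. g (\<phi> z) m n * coord_fun m (frame k z) * coord_fun n (frame l z)) y
      = (\<Sum>m\<in>UNIV. D (\<lambda>z. \<Sum>n\<in>UNIV. g (\<phi> z) m n * coord_fun m (frame k z) * coord_fun n (frame l z)) y)"
      by (rule D_sum) (intro differentiable_sum differentiable_mult d finite ballI)
    ultimately show ?thesis by simp
  qed
  also have "\<dots> = (\<Sum>m\<in>UNIV. \<Sum>n\<in>UNIV.
      (\<Sum>j\<in>UNIV. X (\<phi> y) j * pd j (\<lambda>q. g q m n) (\<phi> y)) * coord_fun m (frame k y) * coord_fun n (frame l y)
      + g (\<phi> y) m n * (\<Sum>j\<in>UNIV. coord_fun j (frame k y) * pd j (\<lambda>q. X q m) (\<phi> y)) * coord_fun n (frame l y)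
      + g (\<phi> y) m n * coord_fun m (frame k y) * (\<Sum>j\<in>UNIV. coord_fun j (frame l y) * pd j (\<lambda>q. X q n) (\<phi> y)))"
    by (simp only: D_mult differentiable_mult d D_g D_frame distrib_right)
  also have "\<dots> = (\<Sum>m\<in>UNIV. \<Sum>n\<in>UNIV. lie_deriv X g (\<phi> y) m n * coord_fun m (frame k y) * coord_fun n (frame l y))"
    by (rule lie_deriv_contracted)
  also have "\<dots> = - 2 * A (\<phi> y) * of_real (metric y $ k $ l)"
    by (simp only: lie metric_eq tensor_at_def sum_distrib_left mult.assoc)
  finally show ?thesis .
qed

text \<open>On the surface the matrix satisfies \<open>dH = \<mu> H\<close> with a real one-form
  \<open>\<mu>\<close>, so it moves only along its own ray and its direction stays fixed.\<close>

lemma metric_conformal: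
  assumes "(\<xi>, \<sigma>) \<in> Y" "(\<xi>, \<sigma>') \<in> Y"
  shows "\<exists>r>0. metric (\<xi>, \<sigma>') = r *\<^sub>R metric (\<xi>, \<sigma>)"
proof -
  obtain \<Sigma> \<Gamma> where \<Sigma>: "open \<Sigma>" "connected \<Sigma>" "\<sigma> \<in> \<Sigma>" "\<sigma>' \<in> \<Sigma>"
    and in_Y: "\<forall>\<tau>\<in>\<Sigma>. (\<xi>, \<tau>) \<in> Y \<and> \<phi> (\<xi>, \<tau>) = \<Gamma> \<tau>"
    by (rule integral_surface_in_chart[OF assms]) (rule that; assumption)
  define H where "H \<tau> = metric (\<xi>, \<tau>)" for \<tau>
  have H0: "H \<tau> \<noteq> 0" if "\<tau> \<in> \<Sigma>" for \<tau>
  proof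
    assume "H \<tau> = 0"
    then have "det (metric (\<xi>, \<tau>)) = 0" by (simp add: H_def det_0 flip: mat_0)
    then show False using det_metric in_Y that by blast
  qed
  have "\<exists>\<mu>. (H has_derivative (\<lambda>w. \<mu> w *\<^sub>R H \<tau>)) (at \<tau>)" if \<tau>: "\<tau> \<in> \<Sigma>" for \<tau>
  proof -
    let ?y = "(\<xi>, \<tau>)"
    let ?L = "frechet_derivative metric (at ?y)"
    have y: "?y \<in> Y" using in_Y \<tau> by blast
    \<comment> \<open>The derivative in the direction \<open>w\<close> is
      \<open>w \<partial>\<^sub>s + w\<^sup>* \<partial>\<^sub>s\<^sub>*\<close>, and both terms are
      multiples of \<open>H\<close>. As \<open>H\<close> and its real derivative are real, taking
      the real part of the factor loses nothing.\<close>
    define \<mu> where "\<mu> w = Re (w * (- 2 * As (\<phi> ?y)) + cnj w * (- 2 * Asc (\<phi> ?y)))" for w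
    have "((\<lambda>\<tau>. (\<xi>, \<tau>)) has_derivative (\<lambda>w. (0, w))) (at \<tau>)"
      by (auto intro!: derivative_eq_intros)
    from has_derivative_compose[OF this smooth_on_has_derivative[OF smooth_metric y]]
    have H: "(H has_derivative (\<lambda>w. ?L (0, w))) (at \<tau>)" by (simp add: H_def[abs_def])
    have "?L (0, w) = \<mu> w *\<^sub>R H \<tau>" for w
    proof -
      have "?L (0, w) $ k $ l = \<mu> w * H \<tau> $ k $ l" for k l
      proof -
        let ?f = "\<lambda>z. complex_of_real (metric z $ k $ l)"
        let ?K = "frechet_derivative ?f (at ?y)"
        have bl: "bounded_linear (\<lambda>h :: real ^ 4 ^ 4. complex_of_real (h $ k $ l))"
          by (intro bounded_linear_compose[OF bounded_linear_of_real]
              bounded_linear_compose[OF bounded_linear_vec_nth bounded_linear_vec_nth])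
        have K: "?K v = of_real (?L v $ k $ l)" for v
          by (rule frechet_derivative_bounded_linear_compose[OF bl smooth_on_imp_differentiable[OF smooth_metric y]])
        have lin: "linear ?K"
          using smooth_on_has_derivative[OF smooth_on_bounded_linear_compose[OF open_Y bl smooth_metric] y]
          by (rule has_derivative_linear)
        have w: "(0, w) = Re w *\<^sub>R (0, 1) + Im w *\<^sub>R (0, \<i>)" by (simp add: complex_eq_iff)
        have "?K (0, w) = Re w *\<^sub>R ?K (0, 1) + Im w *\<^sub>R ?K (0, \<i>)"
          by (subst w) (simp only: linear_add[OF lin] linear_cmul[OF lin])
        also have "\<dots> = w * chart_ds ?f ?y + cnj w * chart_dsc ?f ?y"
          unfolding chart_ds_def chart_dsc_def wirt_def wirt_cnj_def by (rule real_imag_eq_wirt)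
        also have "\<dots> = (w * (- 2 * As (\<phi> ?y)) + cnj w * (- 2 * Asc (\<phi> ?y))) * of_real (H \<tau> $ k $ l)"
          using chart_derivative_metric[OF _ y, of chart_ds "e_s S" As k l]
            chart_derivative_metric[OF _ y, of chart_dsc "e_sc S" Asc k l]
          by (simp add: H_def algebra_simps)
        finally have "Re (?K (0, w)) = \<mu> w * H \<tau> $ k $ l" by (simp add: \<mu>_def)
        then show ?thesis by (simp add: K)
      qed
      then show ?thesis by (simp add: vec_eq_iff)
    qed
    with H show ?thesis by auto
  qed
  then obtain \<mu> where H: "(H has_derivative (\<lambda>w. \<mu> \<tau> w *\<^sub>R H \<tau>)) (at \<tau>)" if "\<tau> \<in> \<Sigma>" for \<tau>
    by metis
  define N where "N \<tau> = inverse (norm (H \<tau>)) *\<^sub>R H \<tau>" for \<tau>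
  have N: "(N has_derivative (\<lambda>w. 0)) (at \<tau>)" if \<tau>: "\<tau> \<in> \<Sigma>" for \<tau>
  proof -
    \<comment> \<open>The derivative of the norm is the inner product of \<open>H / norm H\<close>
      with \<open>\<mu> H\<close>, that is \<open>\<mu>\<close> times the norm. It grows at the same
      relative rate as \<open>H\<close>, and the quotient rule cancels the two.\<close>
    have n: "((\<lambda>\<tau>. norm (H \<tau>)) has_derivative (\<lambda>w. \<mu> \<tau> w * norm (H \<tau>))) (at \<tau>)"
      using has_derivative_compose[OF H[OF \<tau>] has_derivative_norm[OF H0[OF \<tau>]]]
      by (rule has_derivative_eq_rhs)
        (simp add: H0[OF \<tau>] fun_eq_iff sgn_div_norm dot_square_norm power2_eq_square)
    have "(N has_derivative (\<lambda>w. inverse (norm (H \<tau>)) *\<^sub>R \<mu> \<tau> w *\<^sub>R H \<tau>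
        + (- (inverse (norm (H \<tau>)) * (\<mu> \<tau> w * norm (H \<tau>)) * inverse (norm (H \<tau>)))) *\<^sub>R H \<tau>)) (at \<tau>)"
      unfolding N_def[abs_def]
      by (intro has_derivative_scaleR Deriv.has_derivative_inverse n H \<tau>) (simp add: H0[OF \<tau>])
    then show ?thesis by (rule has_derivative_eq_rhs) (simp add: H0[OF \<tau>] fun_eq_iff)
  qed
  then have "N constant_on \<Sigma>"
    by (intro has_derivative_zero_connected_constant_on[of \<Sigma> "{}"] \<Sigma>)
      (auto intro!: has_derivative_continuous_on[of \<Sigma> N "\<lambda>_ _. 0"] intro: has_derivative_at_withinI)
  then have N_eq: "N \<sigma>' = N \<sigma>" using \<Sigma>(3,4) by (auto simp: constant_on_def)
  have "H \<sigma>' = norm (H \<sigma>') *\<^sub>R N \<sigma>'" using H0[OF \<Sigma>(4)] by (simp add: N_def)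
  \<comment> \<open>The conformal factor is the ratio of the two norms, which is positive because
    \<open>H\<close> never vanishes on \<open>\<Sigma>\<close>.\<close>
  then have "H \<sigma>' = (norm (H \<sigma>') / norm (H \<sigma>)) *\<^sub>R H \<sigma>"
    unfolding N_eq by (simp add: N_def divide_inverse)
  moreover have "norm (H \<sigma>') / norm (H \<sigma>) > 0" using H0 \<Sigma>(3,4) by simp
  ultimately show ?thesis unfolding H_def by blast
qed

end

theorem theorem1:
  fixes U :: "jet set" and S :: "jet \<Rightarrow> complex"
    and \<Phi> \<alpha> c :: "jet \<Rightarrow> real" and b a :: "jet \<Rightarrow> complex"
    and \<theta> :: "tet \<Rightarrow> form1" and g :: tensor2
    and \<omega> :: "tet \<Rightarrow> tet \<Rightarrow> form1"
    and At :: "tet \<Rightarrow> jet \<Rightarrow> complex" and As Asc :: "jet \<Rightarrow> complex"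
  assumes "integrable_pde_pair U S"
    and "tetrad_params U \<Phi> \<alpha> b a c"
    and "\<theta> = theta S \<Phi> \<alpha> b a c"
    and "g = tetrad_metric \<theta>"
    and "torsion_free_gen_weyl U \<theta> \<omega> (weyl_form \<theta> At As Asc)"
  shows "(\<forall>p\<in>U. \<forall>m n. lie_deriv (e_s S) g p m n = - 2 * As p * g p m n \<and>
                     lie_deriv (e_sc S) g p m n = - 2 * Asc p * g p m n) \<and>
    (\<forall>V x Y \<phi>. solution_coords U S V x Y \<phi> \<longrightarrow>
      (\<exists>G :: (real ^ 4) \<times> complex \<Rightarrow> real ^ 4 ^ 4.
         smooth_on Y G \<and>
         (\<forall>p\<in>V. \<forall>m n. g p m n =
            (\<Sum>k\<in>UNIV. \<Sum>l\<in>UNIV. of_real (G (x p, js p) $ k $ l)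
               * dfun (\<lambda>q. of_real (x q $ k)) p m * dfun (\<lambda>q. of_real (x q $ l)) p n)) \<and>
         (\<forall>y\<in>Y. transpose (G y) = G y \<and> det (G y) \<noteq> 0) \<and>
         (\<forall>y\<in>Y. \<forall>k l.
            chart_ds (\<lambda>z. of_real (G z $ k $ l)) y = - 2 * As (\<phi> y) * of_real (G y $ k $ l) \<and>
            chart_dsc (\<lambda>z. of_real (G z $ k $ l)) y = - 2 * Asc (\<phi> y) * of_real (G y $ k $ l)) \<and>
         (\<forall>\<xi> \<sigma> \<sigma>'. (\<xi>, \<sigma>) \<in> Y \<longrightarrow> (\<xi>, \<sigma>') \<in> Y \<longrightarrow>
            (\<exists>r>0. G (\<xi>, \<sigma>') = r *\<^sub>R G (\<xi>, \<sigma>)))))"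
proof (rule conjI)
  show "\<forall>p\<in>U. \<forall>m n. lie_deriv (e_s S) g p m n = - 2 * As p * g p m n \<and>
                     lie_deriv (e_sc S) g p m n = - 2 * Asc p * g p m n"
    using lie_deriv_tetrad_metric_e_s[OF assms(1,2,3,5)] unfolding assms(4) by blast
next
  show "\<forall>V x Y \<phi>. solution_coords U S V x Y \<phi> \<longrightarrow>
      (\<exists>G :: (real ^ 4) \<times> complex \<Rightarrow> real ^ 4 ^ 4.
         smooth_on Y G \<and>
         (\<forall>p\<in>V. \<forall>m n. g p m n =
            (\<Sum>k\<in>UNIV. \<Sum>l\<in>UNIV. of_real (G (x p, js p) $ k $ l)
               * dfun (\<lambda>q. of_real (x q $ k)) p m * dfun (\<lambda>q. of_real (x q $ l)) p n)) \<and>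
         (\<forall>y\<in>Y. transpose (G y) = G y \<and> det (G y) \<noteq> 0) \<and>
         (\<forall>y\<in>Y. \<forall>k l.
            chart_ds (\<lambda>z. of_real (G z $ k $ l)) y = - 2 * As (\<phi> y) * of_real (G y $ k $ l) \<and>
            chart_dsc (\<lambda>z. of_real (G z $ k $ l)) y = - 2 * Asc (\<phi> y) * of_real (G y $ k $ l)) \<and>
         (\<forall>\<xi> \<sigma> \<sigma>'. (\<xi>, \<sigma>) \<in> Y \<longrightarrow> (\<xi>, \<sigma>') \<in> Y \<longrightarrow>
            (\<exists>r>0. G (\<xi>, \<sigma>') = r *\<^sub>R G (\<xi>, \<sigma>))))"
  proof (intro allI impI)
    fix V x Y \<phi>
    assume "solution_coords U S V x Y \<phi>"
    \<comment> \<open>The chart is arbitrary, and the frame matrix \<open>metric\<close> that it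
      determines is the witness for \<open>G\<close>.\<close>
    then interpret weyl_chart U S V x Y \<phi> \<Phi> \<alpha> c b a \<theta> \<omega> At As Asc
      by unfold_locales (use assms in auto)
    show "\<exists>G :: (real ^ 4) \<times> complex \<Rightarrow> real ^ 4 ^ 4.
         smooth_on Y G \<and>
         (\<forall>p\<in>V. \<forall>m n. g p m n =
            (\<Sum>k\<in>UNIV. \<Sum>l\<in>UNIV. of_real (G (x p, js p) $ k $ l)
               * dfun (\<lambda>q. of_real (x q $ k)) p m * dfun (\<lambda>q. of_real (x q $ l)) p n)) \<and>
         (\<forall>y\<in>Y. transpose (G y) = G y \<and> det (G y) \<noteq> 0) \<and>
         (\<forall>y\<in>Y. \<forall>k l.
            chart_ds (\<lambda>z. of_real (G z $ k $ l)) y = - 2 * As (\<phi> y) * of_real (G y $ k $ l) \<and>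
            chart_dsc (\<lambda>z. of_real (G z $ k $ l)) y = - 2 * Asc (\<phi> y) * of_real (G y $ k $ l)) \<and>
         (\<forall>\<xi> \<sigma> \<sigma>'. (\<xi>, \<sigma>) \<in> Y \<longrightarrow> (\<xi>, \<sigma>') \<in> Y \<longrightarrow>
            (\<exists>r>0. G (\<xi>, \<sigma>') = r *\<^sub>R G (\<xi>, \<sigma>)))"
      unfolding assms(4)
    proof (intro exI[of _ metric] conjI ballI allI impI)
      show "chart_ds (\<lambda>z. of_real (metric z $ k $ l)) y = - 2 * As (\<phi> y) * of_real (metric y $ k $ l)"
        if "y \<in> Y" for y k l
        by (rule chart_derivative_metric[OF _ that]) blast
      show "chart_dsc (\<lambda>z. of_real (metric z $ k $ l)) y = - 2 * Asc (\<phi> y) * of_real (metric y $ k $ l)"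
        if "y \<in> Y" for y k l
        by (rule chart_derivative_metric[OF _ that]) blast
    qed (rule smooth_metric g_eq_metric transpose_metric det_metric metric_conformal; assumption)+
  qed
qed

end
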